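(* Let $n=|E|$, let $k$ be the cardinality constraint, and let $\epsilon$ be the accuracy parameter of the Linear-Time Adaptive Policy $\pi^{lt}$, which is run with $q=8k^{-1}\epsilon^{-2}\cdot\ln (2\epsilon)^{-1}$ and $s=k\min\{\lceil qn\rceil,n\}/n$. If $f:2^E\times O^E\to\mathbb{R}_{\ge 0}$ is adaptive submodular and adaptive monotone with respect to the prior $p$, then $\pi^{lt}$ achieves a $1-1/e-\epsilon$ approximation ratio in expectation, i.e. $$f_{avg}(\pi^{lt})\ \ge\ \left(1-\frac1e-\epsilon\right) f_{avg}(\pi^{opt}),$$ with $O(n\epsilon^{-2}\log\epsilon^{-1})$ value oracle queries.
   Context: **Items, states, realizations.** $E$ is a set of $n$ items, $O$ is a set of states. A realization is a map $\phi:E\to O$; $U$ is the set of all realizations. $\Phi$ is a random realization drawn from a known prior distribution $p(\phi)=\Pr[\Phi=\phi]$. A partial realization $\psi$ is a map from a subset $\mathrm{dom}(\psi)\subseteq E$ to $O$; $\phi\sim\psi$ means that $\phi$ agrees with $\psi$ on $\mathrm{dom}(\psi)$; $\psi\subseteq\psi'$ means $\mathrm{dom}(\psi)\subseteq\mathrm{dom}(\psi')$ and they agree on $\mathrm{dom}(\psi)$. Partial realizations are those with $\Pr[\Phi\sim\psi]>0$, so that conditioning on $\Phi\sim\psi$ makes sense. The utility function is $f:2^E\times O^E\to\mathbb{R}_{\ge0}$. **Marginal utilities.** $\Delta(e\mid\psi)=\mathbb{E}[f(\mathrm{dom}(\psi)\cup\{e\},\Phi)-f(\mathrm{dom}(\psi),\Phi)\mid\Phi\sim\psi]$.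 A value oracle query returns $\Delta(e\mid\psi)$ for an item $e\in E$ and a partial realization $\psi$. $f$ is adaptive submodular with respect to $p$ if $\Delta(e\mid\psi)\ge\Delta(e\mid\psi')$ for all partial realizations $\psi\subseteq\psi'$ and all $e\in E\setminus\mathrm{dom}(\psi')$. $f$ is adaptive monotone with respect to $p$ if $\Delta(e\mid\psi)\ge0$ for all partial realizations $\psi$ and all $e\in E$. **Policies.** A policy $\pi$ is a (possibly randomized) adaptive rule which, given the partial realization of the items selected so far, decides which item to select next (or to stop); the state of an item is observed after it is selected. $E(\pi,\phi)$ is the set of items selected by $\pi$ under $\phi$, and $f_{avg}(\pi)=\mathbb{E}[f(E(\pi,\Phi),\Phi)]$, the expectation being over $\Phi\sim p$ and the internal randomness of $\pi$. A policy is feasible if it selects at most $k$ items under every realization. $\pi^{opt}$ is a feasible policy maximizing $f_{avg}$ over all feasible policies. **Policy $\pi^{lt}$ (parameters $q,s$).** For rounds $r=1,\dots,k$: with $\psi^{r-1}$ the partial realization of the items selected in the first $r-1$ rounds, let $S_r$ be a random set of size $\min\{\lceil qn\rceil,n\}$ sampled uniformly at random from $E$; let $d_r$ be sampled uniformly at random from $(0,s]$; let $e'_r$ be the item of $S_r$ with the $\lceil d_r\rceil$-th largest marginal utility $\Delta(\cdot\mid\psi^{r-1})$. If $\Delta(e'_r\mid\psi^{r-1})\ge0$, select $e_r=e'_r$ and observe its state; otherwise select nothing in this round.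
   Formalization: With q as printed, ln((2ε)^{-1}), the claim fails for ε near 1/2 (n=10, k=1, ε=0.4995) and q ≤ 0 for ε ≥ 1/2; it is proved for ε ≤ 0.49, and with ln(2ε^{-1}) in place of the printed logarithm for all 0 < ε < 1-1/e; 1 ≤ k ≤ n is assumed. *)

theory Defs
  imports "HOL-Probability.Probability"
begin

section \<open>Stochastic items\<close>

text \<open>
  Items are elements of a finite set \<open>E\<close>, states are elements of \<open>St\<close>, and a realization is an
  element of \<open>E \<rightarrow>\<^sub>E St\<close>. The prior is a probability mass function on realizations. The state set
  may be infinite, so the existence of the expectations of \<open>f A\<close> is required explicitly; it is
  automatic when \<open>St\<close> is finite.
\<close>

definition stochastic_instance ::
  "'a set \<Rightarrow> 'b set \<Rightarrow> ('a \<Rightarrow> 'b) pmf \<Rightarrow> ('a set \<Rightarrow> ('a \<Rightarrow> 'b) \<Rightarrow> real) \<Rightarrow> bool" where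
  "stochastic_instance E St p f \<longleftrightarrow>
     finite E \<and> set_pmf p \<subseteq> E \<rightarrow>\<^sub>E St \<and>
     (\<forall>A\<subseteq>E. \<forall>\<phi>\<in>E \<rightarrow>\<^sub>E St. 0 \<le> f A \<phi>) \<and>
     (\<forall>A\<subseteq>E. integrable (measure_pmf p) (f A))"

definition consistent :: "('a \<rightharpoonup> 'b) \<Rightarrow> ('a \<Rightarrow> 'b) set" where
  "consistent \<psi> = {\<phi>. \<forall>e\<in>dom \<psi>. \<psi> e = Some (\<phi> e)}"

definition partial_realization ::
  "'a set \<Rightarrow> 'b set \<Rightarrow> ('a \<Rightarrow> 'b) pmf \<Rightarrow> ('a \<rightharpoonup> 'b) \<Rightarrow> bool" where
  "partial_realization E St p \<psi> \<longleftrightarrow>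
     dom \<psi> \<subseteq> E \<and> ran \<psi> \<subseteq> St \<and> measure_pmf.prob p (consistent \<psi>) > 0"

definition marginal ::
  "('a \<Rightarrow> 'b) pmf \<Rightarrow> ('a set \<Rightarrow> ('a \<Rightarrow> 'b) \<Rightarrow> real) \<Rightarrow> 'a \<Rightarrow> ('a \<rightharpoonup> 'b) \<Rightarrow> real" where
  "marginal p f e \<psi> =
     measure_pmf.expectation (cond_pmf p (consistent \<psi>))
       (\<lambda>\<phi>. f (dom \<psi> \<union> {e}) \<phi> - f (dom \<psi>) \<phi>)"

definition adaptive_submodular ::
  "'a set \<Rightarrow> 'b set \<Rightarrow> ('a \<Rightarrow> 'b) pmf \<Rightarrow> ('a set \<Rightarrow> ('a \<Rightarrow> 'b) \<Rightarrow> real) \<Rightarrow> bool" where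
  "adaptive_submodular E St p f \<longleftrightarrow>
     (\<forall>\<psi> \<psi>'. partial_realization E St p \<psi> \<longrightarrow> partial_realization E St p \<psi>' \<longrightarrow> \<psi> \<subseteq>\<^sub>m \<psi>' \<longrightarrow>
        (\<forall>e\<in>E - dom \<psi>'. marginal p f e \<psi> \<ge> marginal p f e \<psi>'))"

definition adaptive_monotone ::
  "'a set \<Rightarrow> 'b set \<Rightarrow> ('a \<Rightarrow> 'b) pmf \<Rightarrow> ('a set \<Rightarrow> ('a \<Rightarrow> 'b) \<Rightarrow> real) \<Rightarrow> bool" where
  "adaptive_monotone E St p f \<longleftrightarrow>
     (\<forall>\<psi>. partial_realization E St p \<psi> \<longrightarrow> (\<forall>e\<in>E. marginal p f e \<psi> \<ge> 0))"


section \<open>Policies\<close>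

text \<open>
  A policy is a well-founded decision tree. At \<open>Select e c\<close> the item \<open>e\<close> is selected, its state \<open>o\<close>
  is observed, and the policy goes on as \<open>c o\<close>; \<open>Flip P\<close> draws the rest of the policy at random.
  The action at a node may thus depend on the states observed so far (the partial realization of
  the selected items) and on all internal randomness used so far. Selecting an item again has no
  effect on the set of selected items.
\<close>

datatype ('a, 'b) policy =
    Stop
  | Select 'a "'b \<Rightarrow> ('a, 'b) policy"
  | Flip "('a, 'b) policy pmf"

text \<open>The distribution of the set of selected items under a realization \<open>\<phi>\<close>, over the internal
  randomness of the policy.\<close>

primrec selected :: "('a \<Rightarrow> 'b) \<Rightarrow> ('a, 'b) policy \<Rightarrow> 'a set pmf" where
  "selected \<phi> Stop = return_pmf {}"
| "selected \<phi> (Select e c) = map_pmf (insert e) (selected \<phi> (c (\<phi> e)))"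
| "selected \<phi> (Flip P) = join_pmf (map_pmf (selected \<phi>) P)"

definition f_avg ::
  "('a \<Rightarrow> 'b) pmf \<Rightarrow> ('a set \<Rightarrow> ('a \<Rightarrow> 'b) \<Rightarrow> real) \<Rightarrow> ('a, 'b) policy \<Rightarrow> real" where
  "f_avg p f \<pi> =
     measure_pmf.expectation p (\<lambda>\<phi>. measure_pmf.expectation (selected \<phi> \<pi>) (\<lambda>A. f A \<phi>))"

definition feasible :: "'a set \<Rightarrow> 'b set \<Rightarrow> nat \<Rightarrow> ('a, 'b) policy \<Rightarrow> bool" where
  "feasible E St k \<pi> \<longleftrightarrow>
     (\<forall>\<phi>\<in>E \<rightarrow>\<^sub>E St. \<forall>A\<in>set_pmf (selected \<phi> \<pi>). A \<subseteq> E \<and> card A \<le> k)"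

definition optimal_policy ::
  "'a set \<Rightarrow> 'b set \<Rightarrow> ('a \<Rightarrow> 'b) pmf \<Rightarrow> ('a set \<Rightarrow> ('a \<Rightarrow> 'b) \<Rightarrow> real) \<Rightarrow> nat \<Rightarrow>
   ('a, 'b) policy \<Rightarrow> bool" where
  "optimal_policy E St p f k \<pi> \<longleftrightarrow>
     feasible E St k \<pi> \<and> (\<forall>\<pi>'. feasible E St k \<pi>' \<longrightarrow> f_avg p f \<pi>' \<le> f_avg p f \<pi>)"


section \<open>Value oracle algorithms\<close>

text \<open>
  An algorithm has no access to the prior and the utility function except through
  \<open>Query e \<psi> c\<close>, which receives the oracle's answer for the item \<open>e\<close> and the partial realization
  \<open>\<psi>\<close>. Once an oracle is supplied, the algorithm implements a policy and makes a random number
  of queries.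
\<close>

datatype ('a, 'b) alg =
    Done
  | Pick 'a "'b \<Rightarrow> ('a, 'b) alg"
  | Rand "('a, 'b) alg pmf"
  | Query 'a "'a \<rightharpoonup> 'b" "real \<Rightarrow> ('a, 'b) alg"

primrec policy_of :: "('a \<Rightarrow> ('a \<rightharpoonup> 'b) \<Rightarrow> real) \<Rightarrow> ('a, 'b) alg \<Rightarrow> ('a, 'b) policy" where
  "policy_of V Done = Stop"
| "policy_of V (Pick e c) = Select e (\<lambda>st. policy_of V (c st))"
| "policy_of V (Rand P) = Flip (map_pmf (policy_of V) P)"
| "policy_of V (Query e \<psi> c) = policy_of V (c (V e \<psi>))"

primrec query_count ::
  "('a \<Rightarrow> ('a \<rightharpoonup> 'b) \<Rightarrow> real) \<Rightarrow> ('a \<Rightarrow> 'b) \<Rightarrow> ('a, 'b) alg \<Rightarrow> nat pmf" where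
  "query_count V \<phi> Done = return_pmf 0"
| "query_count V \<phi> (Pick e c) = query_count V \<phi> (c (\<phi> e))"
| "query_count V \<phi> (Rand P) = join_pmf (map_pmf (query_count V \<phi>) P)"
| "query_count V \<phi> (Query e \<psi> c) = map_pmf Suc (query_count V \<phi> (c (V e \<psi>)))"


section \<open>The linear-time adaptive policy\<close>

text \<open>The distribution of \<open>\<lceil>d\<rceil>\<close> for \<open>d\<close> uniform on \<open>(0, s]\<close>.\<close>

definition rank_pmf :: "real \<Rightarrow> nat pmf" where
  "rank_pmf s =
     Abs_pmf (distr (uniform_measure lborel {0<..s}) (count_space UNIV) (\<lambda>d. nat \<lceil>d\<rceil>))"

lemma measure_pmf_rank_pmf:
  assumes "s > 0"
  shows "measure_pmf (rank_pmf s) =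
    distr (uniform_measure lborel {0<..s}) (count_space UNIV) (\<lambda>d. nat \<lceil>d\<rceil>)"
proof -
  let ?U = "uniform_measure lborel {0<..s}"
  let ?D = "distr ?U (count_space UNIV) (\<lambda>d. nat \<lceil>d\<rceil>)"
  interpret U: prob_space ?U
    by (rule prob_space_uniform_measure) (use assms in auto)
  have "prob_space ?D"
    by (rule U.prob_space_distr) measurable
  then interpret D: prob_space ?D .
  have "AE x in ?D. measure ?D {x} \<noteq> 0"
    by (subst D.AE_support_countable) (auto intro: exI[of _ UNIV])
  with \<open>prob_space ?D\<close> show ?thesis
    unfolding rank_pmf_def by (intro Abs_pmf_inverse) auto
qed

text \<open>A rule that lists a finite set of items by decreasing value, breaking ties in an arbitrary
  way.\<close>

definition ranking_rule :: "(('a \<Rightarrow> real) \<Rightarrow> 'a set \<Rightarrow> 'a list) \<Rightarrow> bool" where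
  "ranking_rule rk \<longleftrightarrow>
     (\<forall>v S. finite S \<longrightarrow>
        distinct (rk v S) \<and> set (rk v S) = S \<and> sorted_wrt (\<lambda>x y. v x \<ge> v y) (rk v S))"

text \<open>Query the items of a list one after the other, all at \<open>\<psi>\<close>, and pass on the table of answers;
  \<open>v\<close> is the table so far.\<close>

primrec query_all ::
  "'a list \<Rightarrow> ('a \<rightharpoonup> 'b) \<Rightarrow> (('a \<Rightarrow> real) \<Rightarrow> ('a, 'b) alg) \<Rightarrow> ('a \<Rightarrow> real) \<Rightarrow> ('a, 'b) alg" where
  "query_all [] \<psi> c v = c v"
| "query_all (x # xs) \<psi> c v = Query x \<psi> (\<lambda>y. query_all xs \<psi> c (v(x := y)))"

definition enum_set :: "'a set \<Rightarrow> 'a list" where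
  "enum_set S = (SOME xs. distinct xs \<and> set xs = S)"

text \<open>The first argument is the number of remaining rounds and \<open>\<psi>\<close> the partial realization of the
  items selected so far. The list \<open>rk v S\<close> starts at position 0, so the item of rank \<open>j \<ge> 1\<close> is at
  position \<open>j - 1\<close>.\<close>

primrec lt_rounds ::
  "nat \<Rightarrow> 'a set \<Rightarrow> nat \<Rightarrow> real \<Rightarrow> (('a \<Rightarrow> real) \<Rightarrow> 'a set \<Rightarrow> 'a list) \<Rightarrow>
   ('a \<rightharpoonup> 'b) \<Rightarrow> ('a, 'b) alg" where
  "lt_rounds 0 E m s rk \<psi> = Done"
| "lt_rounds (Suc r) E m s rk \<psi> =
     Rand (map_pmf
       (\<lambda>(S, j). query_all (enum_set S) \<psi>
          (\<lambda>v. let e = rk v S ! (j - 1) in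
               if v e \<ge> 0 then Pick e (\<lambda>st. lt_rounds r E m s rk (\<psi>(e \<mapsto> st)))
               else lt_rounds r E m s rk \<psi>)
          (\<lambda>_. 0))
       (pair_pmf (pmf_of_set {S. S \<subseteq> E \<and> card S = m}) (rank_pmf s)))"

definition linear_time_alg ::
  "'a set \<Rightarrow> nat \<Rightarrow> real \<Rightarrow> (('a \<Rightarrow> real) \<Rightarrow> 'a set \<Rightarrow> 'a list) \<Rightarrow> ('a, 'b) alg" where
  "linear_time_alg E k q rk =
     (let n = card E; m = nat (min \<lceil>q * real n\<rceil> (int n)); s = real k * real m / real n
      in lt_rounds k E m s rk Map.empty)"

text \<open>
  The sampling rate is written \<open>q = 8 k\<^sup>-\<^sup>1 \<epsilon>\<^sup>-\<^sup>2 \<cdot> ln (2\<epsilon>)\<^sup>-\<^sup>1\<close>, where the exponent can be attached to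
  \<open>\<epsilon>\<close> or to \<open>2\<epsilon>\<close>; both parameter choices are admitted. The second logarithm vanishes at
  \<open>\<epsilon> = 1/2\<close>, and the approximation guarantee fails for \<open>\<epsilon>\<close> slightly below \<open>1/2\<close>: with \<open>n = 10\<close>,
  \<open>k = 1\<close> and \<open>\<epsilon> = 0.4995\<close> the sample has a single item, so that the policy selects one uniformly
  random item and its ratio can be \<open>1/10 < 1 - 1/e - \<epsilon>\<close>. Hence the bound on \<open>\<epsilon>\<close> in that case.
\<close>

definition sampling_rate :: "nat \<Rightarrow> real \<Rightarrow> real \<Rightarrow> bool" where
  "sampling_rate k \<epsilon> q \<longleftrightarrow>
     q = 8 / (real k * \<epsilon>\<^sup>2) * ln (2 / \<epsilon>) \<or>
     q = 8 / (real k * \<epsilon>\<^sup>2) * ln (1 / (2 * \<epsilon>)) \<and> \<epsilon> \<le> 49 / 100"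

end

theory Submission
  imports Defs "HOL-Combinatorics.Transposition"
begin

text \<open>
  Write \<open>\<delta> = \<epsilon> / (1 - 1/e)\<close>. Let \<open>K\<close> be the \<open>k\<close> items of largest marginal utility at \<open>\<psi>\<close> and
  \<open>X = |S \<inter> K|\<close> for the random sample \<open>S\<close>, so that \<open>E X = s\<close>. Given \<open>S\<close>, the expected marginal
  utility at the random rank is at least \<open>min 1 (s / X) / s\<close> times the total marginal utility of
  \<open>S \<inter> K\<close> (Chebyshev's sum inequality). By symmetry all items of \<open>K\<close> contribute equally, so a round
  gains at least \<open>E (min X s) / s\<close> times the average marginal utility over \<open>K\<close>. As \<open>Var X \<le> s\<close>,
  \<open>E (min X s) \<ge> s - sqrt s / 2\<close>, which is at least \<open>(1 - \<delta>) s\<close> for the given sampling rate.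

  By adaptive submodularity, running any feasible policy \<open>\<pi>\<close> after \<open>\<psi>\<close> gains at most the total
  marginal utility of \<open>K\<close>; by adaptive monotonicity, selecting an item before \<open>\<pi>\<close> does not decrease
  the value of \<open>\<pi>\<close>. Hence each round closes a fraction \<open>(1 - \<delta>) / k\<close> of the gap to \<open>\<pi>\<close>, and \<open>k\<close>
  rounds give the ratio \<open>1 - (1 - (1 - \<delta>) / k)^k \<ge> (1 - 1/e) (1 - \<delta>) = 1 - 1/e - \<epsilon>\<close>, by convexity
  of \<open>exp\<close>.
\<close>

section \<open>Uniform samples of fixed size\<close>

text \<open>The cardinality bound gives an injection of \<open>A - B\<close> into
  \<open>B - A\<close>, along which \<open>v\<close> never decreases. The common part cancels, and
  what the injection misses in \<open>B - A\<close> is nonnegative.\<close>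

lemma sum_le_sum_exchange:
  fixes v :: "'a \<Rightarrow> real"
  assumes fin: "finite A" "finite B" and card: "card A \<le> card B"
    and le: "\<And>a b. a \<in> A - B \<Longrightarrow> b \<in> B - A \<Longrightarrow> v a \<le> v b"
    and nonneg: "\<And>b. b \<in> B - A \<Longrightarrow> 0 \<le> v b"
  shows "sum v A \<le> sum v B"
proof -
  have "card (A - B) + card (A \<inter> B) \<le> card (B - A) + card (A \<inter> B)"
    using card card_Int_Diff[OF fin(1), of B] card_Int_Diff[OF fin(2), of A]
    by (simp add: Int_commute)
  then obtain g where g: "inj_on g (A - B)" "g ` (A - B) \<subseteq> B - A"
    using card_le_inj[of "A - B" "B - A"] fin by auto
  have "sum v (A - B) \<le> sum (v \<circ> g) (A - B)"
    using g(2) by (auto intro!: sum_mono le)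
  also have "\<dots> = sum v (g ` (A - B))"
    using g(1) by (simp add: sum.reindex)
  also have "\<dots> \<le> sum v (B - A)"
    using fin g(2) nonneg by (intro sum_mono2) auto
  finally show ?thesis
    using sum.Int_Diff[OF fin(1), of v B] sum.Int_Diff[OF fin(2), of v A] by (simp add: Int_commute)
qed

lemma sum_subsets_transpose:
  assumes "a \<in> E" "b \<in> E"
  shows "(\<Sum>S | S \<subseteq> E \<and> card S = m. h (Transposition.transpose a b ` S)) = (\<Sum>S | S \<subseteq> E \<and> card S = m. h S)"
proof -
  let ?t = "image (Transposition.transpose a b)" and ?SS = "{S. S \<subseteq> E \<and> card S = m}"
  have "Transposition.transpose a b ` E = E"
    using assms by (simp add: transpose_image_eq)
  then have mem: "?t S \<in> ?SS" if "S \<in> ?SS" for S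
    using that image_mono[of S E "Transposition.transpose a b"] by (auto simp: card_image)
  show ?thesis
    by (rule sum.reindex_bij_witness[where i = ?t and j = ?t]) (use mem in \<open>simp_all add: image_comp\<close>)
qed

text \<open>Transposing two elements of \<open>K\<close> permutes the \<open>m\<close>-subsets and
  fixes \<open>g\<close>, so the coefficient \<open>D a\<close> of \<open>w a\<close> is the same
  for all \<open>a \<in> K\<close>. Later \<open>K\<close> is the whole set, the set without a
  point, and the set of top items.\<close>

lemma symmetric_sum_subsets:
  fixes g :: "'a set \<Rightarrow> real" and w :: "'a \<Rightarrow> real"
  assumes fin: "finite E" and K: "K \<subseteq> E"
    and sym: "\<And>a b S. a \<in> K \<Longrightarrow> b \<in> K \<Longrightarrow> g (Transposition.transpose a b ` S) = g S"
  shows "card K * (\<Sum>S | S \<subseteq> E \<and> card S = m. g S * sum w (S \<inter> K)) =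
    sum w K * (\<Sum>S | S \<subseteq> E \<and> card S = m. g S * card (S \<inter> K))"
proof -
  define D where "D a = (\<Sum>S | S \<subseteq> E \<and> card S = m. g S * of_bool (a \<in> S))" for a
  have finK: "finite K"
    using fin K finite_subset by blast
  have D_eq: "D a = D b" if "a \<in> K" "b \<in> K" for a b
  proof -
    have "a \<in> Transposition.transpose a b ` S \<longleftrightarrow> b \<in> S" for S
      by (metis (no_types, lifting) image_iff transpose_apply_second transpose_involutory)
    moreover have "a \<in> E" "b \<in> E"
      using that K by auto
    ultimately show ?thesis
      using sum_subsets_transpose[of a E b "\<lambda>S. g S * of_bool (a \<in> S)" m]
      by (simp add: D_def sym[OF that])
  qed
  have expand: "(\<Sum>S | S \<subseteq> E \<and> card S = m. g S * sum u (S \<inter> K)) = (\<Sum>a\<in>K. u a * D a)"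
    for u :: "'a \<Rightarrow> real"
  proof -
    have "sum u (S \<inter> K) = (\<Sum>a\<in>K. u a * of_bool (a \<in> S))" for S
      using finK by (simp add: Int_commute sum.inter_restrict of_bool_def if_distrib cong: if_cong)
    then show ?thesis
      unfolding D_def
      by (simp add: sum_distrib_left) (subst sum.swap, simp add: ac_simps)
  qed
  have "card K * (\<Sum>a\<in>K. w a * D a) = sum w K * (\<Sum>b\<in>K. D b)"
  proof -
    have "(\<Sum>b\<in>K. D b) = card K * D a" if "a \<in> K" for a
      using D_eq[OF that] by (subst sum.cong[where h = "\<lambda>_. D a"]) auto
    then have "sum w K * (\<Sum>b\<in>K. D b) = (\<Sum>a\<in>K. w a * (card K * D a))"
      by (simp add: sum_distrib_right)
    then show ?thesis
      by (simp add: sum_distrib_left mult.left_commute)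
  qed
  then show ?thesis
    using expand[of w] expand[of "\<lambda>_. 1"] by simp
qed

section \<open>Moments of the overlap of a sample with a fixed set\<close>

lemma sum_indicator_Int:
  assumes "finite A"
  shows "sum (indicator K) A = real (card (A \<inter> K))"
  using assms by (simp add: indicator_def sum.If_cases if_distrib of_bool_def cong: if_cong)

text \<open>The mean of a hypergeometric variable: the symmetry lemma on all of \<open>E\<close>,
  where every sample has the same overlap \<open>m\<close>, with the indicator of \<open>K\<close>
  as weight.\<close>

lemma sum_card_Int_subsets:
  assumes "finite E" "K \<subseteq> E"
  shows "card E * (\<Sum>S | S \<subseteq> E \<and> card S = m. real (card (S \<inter> K))) =
    real (card K) * m * card {S. S \<subseteq> E \<and> card S = m}"
proof -
  have finK: "finite K"
    using assms finite_subset by blast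
  have ind: "sum (indicator K) (S \<inter> E) = real (card (S \<inter> K))" if "S \<subseteq> E" for S
    using that assms(1) finite_subset[OF that] by (simp add: sum_indicator_Int Int_absorb2)
  have "(\<Sum>S | S \<subseteq> E \<and> card S = m. 1 * sum (indicator K) (S \<inter> E)) =
      (\<Sum>S | S \<subseteq> E \<and> card S = m. real (card (S \<inter> K)))"
    by (intro sum.cong) (auto simp: ind)
  moreover have "(\<Sum>S | S \<subseteq> E \<and> card S = m. 1 * real (card (S \<inter> E))) =
      (\<Sum>S | S \<subseteq> E \<and> card S = m. real m)"
    by (intro sum.cong) (auto simp: Int_absorb2)
  moreover have "sum (indicator K) E = real (card K)"
    using ind[of E] assms(2) by (simp add: Int_absorb1)
  ultimately show ?thesis
    using symmetric_sum_subsets[OF assms(1) order_refl, of "\<lambda>_. 1" "indicator K" m] by simp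
qed

text \<open>In terms of the overlap \<open>X\<close>, the variance is at most the mean. The square
  counts pairs of elements of \<open>S \<inter> K\<close>, and \<open>1 \<le> m < card E\<close>
  makes \<open>card E - 1\<close> positive for the final division.\<close>

lemma sum_square_card_Int_subsets:
  assumes fin: "finite E" and K: "K \<subseteq> E" and m: "1 \<le> m" "m < card E"
  shows "(\<Sum>S | S \<subseteq> E \<and> card S = m. (real (card (S \<inter> K)))\<^sup>2) \<le>
    (1 + real (card K) * m / card E) * (\<Sum>S | S \<subseteq> E \<and> card S = m. real (card (S \<inter> K)))"
proof -
  let ?SS = "{S. S \<subseteq> E \<and> card S = m}"
  have finK: "finite K"
    using fin K finite_subset by blast
  have swap: "(\<Sum>a\<in>K. \<Sum>S\<in>?SS. of_bool (a \<in> S) * h S) = (\<Sum>S\<in>?SS. card (S \<inter> K) * h S)"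
    for h :: "'a set \<Rightarrow> real"
  proof -
    have "(\<Sum>a\<in>K. of_bool (a \<in> S) * h S) = card (S \<inter> K) * h S" for S
    proof -
      have "K \<inter> {a. a \<in> S} = S \<inter> K"
        by blast
      then show ?thesis
        using finK by (simp add: sum_distrib_right[symmetric] sum_of_bool_eq)
    qed
    then show ?thesis
      by (subst sum.swap) simp
  qed
  \<comment> \<open>Among the samples containing \<open>a\<close>, the other \<open>m - 1\<close>
    elements are spread evenly over \<open>E - {a}\<close>: transpositions within
    \<open>E - {a}\<close> keep \<open>a\<close> fixed, so the symmetry lemma applies there.\<close>
  have pair: "(real (card E) - 1) * (\<Sum>S\<in>?SS. of_bool (a \<in> S) * real (card (S \<inter> K - {a}))) =
      (real (card K) - 1) * (real m - 1) * (\<Sum>S\<in>?SS. of_bool (a \<in> S))" if a: "a \<in> K" for a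
  proof -
    have sym: "of_bool (a \<in> Transposition.transpose b c ` S) = (of_bool (a \<in> S) :: real)"
      if "b \<in> E - {a}" "c \<in> E - {a}" for b c S
    proof -
      have "Transposition.transpose b c a = a"
        using that by (auto intro: transpose_apply_other)
      then have "a \<in> Transposition.transpose b c ` S \<longleftrightarrow> a \<in> S"
        by (metis image_iff transpose_involutory)
      then show ?thesis
        by simp
    qed
    have ind: "sum (indicator K) (S \<inter> (E - {a})) = real (card (S \<inter> K - {a}))" if "S \<subseteq> E" for S
    proof -
      have "S \<inter> (E - {a}) \<inter> K = S \<inter> K - {a}"
        using that by blast
      then show ?thesis
        using fin by (simp add: sum_indicator_Int)
    qed
    have size: "of_bool (a \<in> S) * real (card (S \<inter> (E - {a}))) = (real m - 1) * of_bool (a \<in> S)"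
      if "S \<in> ?SS" for S
    proof -
      have "S \<inter> (E - {a}) = S - {a}" "finite S"
        using that fin finite_subset by auto
      then show ?thesis
        using that m by (auto simp: of_nat_diff)
    qed
    have "real (card (E - {a})) * (\<Sum>S\<in>?SS. of_bool (a \<in> S) * sum (indicator K) (S \<inter> (E - {a}))) =
        sum (indicator K) (E - {a}) * (\<Sum>S\<in>?SS. of_bool (a \<in> S) * real (card (S \<inter> (E - {a}))))"
      by (rule symmetric_sum_subsets) (use fin sym in auto)
    moreover have "sum (indicator K) (E - {a}) = real (card K) - 1"
      using ind[of E] K a finK card_Suc_Diff1[OF finK a] by (simp add: Int_absorb1)
    moreover have "real (card (E - {a})) = real (card E) - 1"
      using fin K a m by (auto simp: of_nat_diff)
    moreover have "(\<Sum>S\<in>?SS. of_bool (a \<in> S) * sum (indicator K) (S \<inter> (E - {a}))) =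
        (\<Sum>S\<in>?SS. of_bool (a \<in> S) * real (card (S \<inter> K - {a})))"
      by (intro sum.cong) (auto simp: ind)
    moreover have "(\<Sum>S\<in>?SS. of_bool (a \<in> S) * real (card (S \<inter> (E - {a})))) =
        (real m - 1) * (\<Sum>S\<in>?SS. of_bool (a \<in> S))"
      unfolding sum_distrib_left by (intro sum.cong size refl)
    ultimately show ?thesis
      by (simp only: mult.assoc)
  qed
  let ?M = "\<Sum>S\<in>?SS. real (card (S \<inter> K))" and ?n = "real (card E)" and ?k = "real (card K)"
  \<comment> \<open>Whenever \<open>a \<in> S \<inter> K\<close>, the overlap is 1 plus the overlap
    outside \<open>a\<close>; summing over \<open>a\<close> produces the square.\<close>
  have "(?n - 1) * (\<Sum>S\<in>?SS. (real (card (S \<inter> K)))\<^sup>2) =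
      (?n - 1) * (\<Sum>a\<in>K. \<Sum>S\<in>?SS. of_bool (a \<in> S) * (1 + real (card (S \<inter> K - {a}))))"
  proof -
    have "of_bool (a \<in> S) * (1 + real (card (S \<inter> K - {a}))) = of_bool (a \<in> S) * real (card (S \<inter> K))"
      if "a \<in> K" for a S
      using that finK card_Suc_Diff1[of "S \<inter> K" a] by auto
    then have "(\<Sum>a\<in>K. \<Sum>S\<in>?SS. of_bool (a \<in> S) * (1 + real (card (S \<inter> K - {a})))) =
        (\<Sum>a\<in>K. \<Sum>S\<in>?SS. of_bool (a \<in> S) * real (card (S \<inter> K)))"
      by (intro sum.cong refl)
    then show ?thesis
      using swap[of "\<lambda>S. real (card (S \<inter> K))"] by (simp only: power2_eq_square)
  qed
  also have "\<dots> = (?n - 1) * ?M + (\<Sum>a\<in>K. (?k - 1) * (real m - 1) * (\<Sum>S\<in>?SS. of_bool (a \<in> S)))"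
    using swap[of "\<lambda>_. 1"] pair
    by (simp add: distrib_left sum.distrib sum_distrib_left[of "?n - 1"] cong: sum.cong)
  also have "\<dots> = ((?n - 1) + (?k - 1) * (real m - 1)) * ?M"
  proof -
    have "(\<Sum>a\<in>K. (?k - 1) * (real m - 1) * (\<Sum>S\<in>?SS. of_bool (a \<in> S))) = (?k - 1) * (real m - 1) * ?M"
      unfolding sum_distrib_left[symmetric] using swap[of "\<lambda>_. 1"] by simp
    then show ?thesis
      by (simp only: distrib_right)
  qed
  finally have eq: "(?n - 1) * (\<Sum>S\<in>?SS. (real (card (S \<inter> K)))\<^sup>2) =
    ((?n - 1) + (?k - 1) * (real m - 1)) * ?M" .
  have n: "?n > 1"
    using m by simp
  have "(?n - 1) + (?k - 1) * (real m - 1) \<le> (?n - 1) * (1 + ?k * m / ?n)"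
  proof -
    have "?n * ((?k - 1) * (real m - 1)) \<le> (?n - 1) * (?k * m)"
    proof -
      have "0 \<le> ?k * (?n - real m) + ?n * (real m - 1)"
        using m by (intro add_nonneg_nonneg mult_nonneg_nonneg) auto
      then show ?thesis
        by (simp add: algebra_simps)
    qed
    then show ?thesis
      using n by (simp add: field_simps)
  qed
  moreover have "?M \<ge> 0"
    by (simp add: sum_nonneg)
  ultimately have "(?n - 1) * (\<Sum>S\<in>?SS. (real (card (S \<inter> K)))\<^sup>2) \<le> (?n - 1) * ((1 + ?k * m / ?n) * ?M)"
    unfolding eq mult.assoc[symmetric] by (rule mult_right_mono)
  then show ?thesis
    using n by simp
qed

lemma sum_min_card_Int_subsets:
  assumes fin: "finite E" and K: "K \<subseteq> E" "K \<noteq> {}" and m: "1 \<le> m" "m < card E"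
    and s: "s = real (card K) * m / card E"
  shows "(1 - 1 / (2 * sqrt s)) * s * card {S. S \<subseteq> E \<and> card S = m} \<le>
    (\<Sum>S | S \<subseteq> E \<and> card S = m. min (real (card (S \<inter> K))) s)"
proof -
  let ?SS = "{S. S \<subseteq> E \<and> card S = m}" and ?X = "\<lambda>S. real (card (S \<inter> K))"
  have "finite K"
    using fin K finite_subset by blast
  then have "card K > 0" "card E > 0"
    using K m fin by (auto simp: card_gt_0_iff)
  then have s_pos: "s > 0"
    unfolding s using m by simp
  \<comment> \<open>\<open>x - min x s \<le> (x - s + a)\<^sup>2 / (4 * a)\<close> for every \<open>a > 0\<close>; \<open>a = sqrt s\<close> minimizes the
    expected right-hand side, which is at most \<open>(s + a\<^sup>2) / (4 * a)\<close>.\<close>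
  define a where "a = sqrt s"
  have a: "a > 0" "a * a = s"
    using s_pos by (auto simp: a_def)
  have finSS: "finite ?SS"
    using fin by simp
  have "card E * sum ?X ?SS = card E * (s * card ?SS)"
    using sum_card_Int_subsets[OF fin K(1), of m] m s by simp
  then have M: "sum ?X ?SS = s * card ?SS"
    using m by simp
  have M2: "(\<Sum>S\<in>?SS. (?X S)\<^sup>2) \<le> (1 + s) * (s * card ?SS)"
    using sum_square_card_Int_subsets[OF fin K(1) m] M s by simp
  have min_ge: "x - (x - s + a)\<^sup>2 / (4 * a) \<le> min x s" for x
  proof -
    have "4 * a * (x - s) \<le> (x - s + a)\<^sup>2"
      using zero_le_power2[of "x - s - a"] by (simp add: power2_eq_square algebra_simps)
    then have "x - s \<le> (x - s + a)\<^sup>2 / (4 * a)"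
      using a by (simp add: field_simps)
    moreover have "0 \<le> (x - s + a)\<^sup>2 / (4 * a)"
      using a by simp
    ultimately show ?thesis
      by linarith
  qed
  have "(\<Sum>S\<in>?SS. (?X S - s + a)\<^sup>2) =
      (\<Sum>S\<in>?SS. (?X S)\<^sup>2 + 2 * (a - s) * ?X S + (a - s)\<^sup>2)"
    by (intro sum.cong) (auto simp: power2_eq_square algebra_simps)
  also have "\<dots> = (\<Sum>S\<in>?SS. (?X S)\<^sup>2) + 2 * (a - s) * (s * card ?SS) + (a - s)\<^sup>2 * card ?SS"
    by (simp add: sum.distrib sum_distrib_left[symmetric] M)
  also have "\<dots> \<le> (1 + s) * (s * card ?SS) + 2 * (a - s) * (s * card ?SS) + (a - s)\<^sup>2 * card ?SS"
    using M2 by simp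
  also have "\<dots> = (s + a * a) * card ?SS"
    by (simp add: power2_eq_square algebra_simps)
  finally have "(\<Sum>S\<in>?SS. (?X S - s + a)\<^sup>2) \<le> 2 * a * a * card ?SS"
    using a by (simp add: mult.assoc)
  then have sq: "(\<Sum>S\<in>?SS. (?X S - s + a)\<^sup>2) / (4 * a) \<le> a / 2 * card ?SS"
    using a(1) by (simp add: field_simps)
  have "(1 - 1 / (2 * sqrt s)) * s * card ?SS = s * card ?SS - a / 2 * card ?SS"
    using a s_pos by (simp add: a_def[symmetric] field_simps)
  also have "\<dots> \<le> s * card ?SS - (\<Sum>S\<in>?SS. (?X S - s + a)\<^sup>2) / (4 * a)"
    using sq by simp
  also have "\<dots> = (\<Sum>S\<in>?SS. ?X S - (?X S - s + a)\<^sup>2 / (4 * a))"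
    by (simp add: sum_subtractf M sum_divide_distrib)
  also have "\<dots> \<le> (\<Sum>S\<in>?SS. min (?X S) s)"
    by (intro sum_mono min_ge)
  finally show ?thesis .
qed


section \<open>Items of random rank\<close>

text \<open>The normalized length of \<open>(i, i + 1] \<inter> (0, s]\<close>, i.e. the probability
  of rank \<open>i + 1\<close>, found at list position \<open>i\<close>. The \<open>max\<close>
  gives weight 0 to positions beyond \<open>s\<close>.\<close>

definition rank_weight :: "real \<Rightarrow> nat \<Rightarrow> real" where
  "rank_weight s i = max 0 (min (real (Suc i)) s - real i) / s"

lemma pmf_rank_pmf_Suc:
  assumes "s > 0"
  shows "pmf (rank_pmf s) (Suc i) = rank_weight s i"
proof -
  have meas: "(\<lambda>d. nat \<lceil>d::real\<rceil>) \<in> uniform_measure lborel {0<..s} \<rightarrow>\<^sub>M count_space UNIV"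
    by measurable
  have "pmf (rank_pmf s) (Suc i) = measure (uniform_measure lborel {0<..s}) {d. nat \<lceil>d\<rceil> = Suc i}"
    using meas by (simp add: pmf.rep_eq measure_pmf_rank_pmf[OF assms] measure_distr vimage_def)
  also have "{d. nat \<lceil>d\<rceil> = Suc i} = {real i<..real (Suc i)}"
    by (auto simp: ceiling_eq_iff nat_eq_iff2) linarith+
  also have "measure (uniform_measure lborel {0<..s}) \<dots> =
      measure lborel ({0<..s} \<inter> {real i<..real (Suc i)}) / measure lborel {0<..s}"
    by (rule measure_uniform_measure) (use assms in auto)
  also have "{0<..s} \<inter> {real i<..real (Suc i)} = {real i<..min (real (Suc i)) s}"
    by auto
  also have "measure lborel \<dots> = max 0 (min (real (Suc i)) s - real i)"
    by (cases "real i \<le> min (real (Suc i)) s") (auto simp: max_def)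
  finally show ?thesis
    using assms by (simp add: rank_weight_def)
qed

text \<open>Rank 0 does not occur, and \<open>s \<le> real m\<close> keeps ranks within a list of
  \<open>m\<close> items, so position \<open>j - 1\<close> always exists.\<close>

lemma set_pmf_rank_pmf:
  assumes "s > 0" "s \<le> real m" and j: "j \<in> set_pmf (rank_pmf s)"
  shows "1 \<le> j" "j \<le> m"
proof -
  have "AE d in uniform_measure lborel {0<..s}. 1 \<le> nat \<lceil>d\<rceil> \<and> nat \<lceil>d\<rceil> \<le> m"
    by (rule AE_uniform_measureI) (use assms in \<open>auto simp: le_nat_iff nat_le_iff ceiling_le_iff\<close>)
  then have "AE j in measure_pmf (rank_pmf s). 1 \<le> j \<and> j \<le> m"
    unfolding measure_pmf_rank_pmf[OF assms(1)] by (subst AE_distr_iff) auto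
  then show "1 \<le> j" "j \<le> m"
    using j by (auto simp: AE_measure_pmf_iff)
qed

lemma sum_rank_weight:
  assumes "s > 0"
  shows "(\<Sum>i<x. rank_weight s i) = min (real x) s / s"
proof (induction x)
  case (Suc x)
  then show ?case
    using assms by (simp add: rank_weight_def field_simps min_def max_def)
qed (use assms in simp)

text \<open>Weights and values both decrease along the list, so by Chebyshev's sum inequality the
  weighted sum is at least the average weight \<open>min x s / (s * x)\<close> times the plain
  sum.\<close>

lemma rank_weighted_sum_ge:
  fixes y :: "nat \<Rightarrow> real"
  assumes s: "s > 0" and y: "\<And>i j. i \<le> j \<Longrightarrow> j < x \<Longrightarrow> y j \<le> y i"
  shows "min 1 (s / x) / s * (\<Sum>i<x. y i) \<le> (\<Sum>i<x. rank_weight s i * y i)"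
proof (cases "x = 0")
  case False
  have w: "rank_weight s j \<le> rank_weight s i" if "i \<le> j" for i j
    using that s unfolding rank_weight_def by (intro divide_right_mono) auto
  \<comment> \<open>Chebyshev's upper bound takes sequences of opposite monotonicity; negation makes
    the weights increasing.\<close>
  have "of_nat x * (\<Sum>i=0..<x. - rank_weight s i * y i) \<le>
      (\<Sum>i=0..<x. - rank_weight s i) * (\<Sum>i=0..<x. y i)"
    by (rule Chebyshev_sum_upper) (use w y in auto)
  then have "(\<Sum>i<x. rank_weight s i) * (\<Sum>i<x. y i) \<le> x * (\<Sum>i<x. rank_weight s i * y i)"
    by (simp add: sum_negf atLeast0LessThan)
  moreover have "min (real x) s = x * min 1 (s / x)"
    using False by (auto simp: min_def field_simps)
  ultimately have "x * (min 1 (s / x) / s * (\<Sum>i<x. y i)) \<le> x * (\<Sum>i<x. rank_weight s i * y i)"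
    by (simp add: sum_rank_weight[OF s] mult.assoc)
  then show ?thesis
    by (rule mult_left_le_imp_le) (use False in simp)
qed simp

section \<open>Top items and ranked samples\<close>

definition top_items :: "nat \<Rightarrow> (('a \<Rightarrow> real) \<Rightarrow> 'a set \<Rightarrow> 'a list) \<Rightarrow> ('a \<Rightarrow> real) \<Rightarrow> 'a set \<Rightarrow> 'a set" where
  "top_items k rk v E = set (take k (rk v E))"

lemma
  assumes rk: "ranking_rule rk" and fin: "finite E" and k: "k \<le> card E"
  shows top_items_subset: "top_items k rk v E \<subseteq> E"
    and card_top_items: "card (top_items k rk v E) = k"
    and top_items_ge: "a \<in> E - top_items k rk v E \<Longrightarrow> b \<in> top_items k rk v E \<Longrightarrow> v a \<le> v b"
proof -
  let ?L = "rk v E"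
  have L: "distinct ?L" "set ?L = E" "sorted_wrt (\<lambda>x y. v x \<ge> v y) ?L"
    using rk fin by (auto simp: ranking_rule_def)
  show "top_items k rk v E \<subseteq> E"
    using L(2) set_take_subset by (fastforce simp: top_items_def)
  have "length ?L = card E"
    using L distinct_card by metis
  then show "card (top_items k rk v E) = k"
    using L(1) k by (simp add: top_items_def distinct_card distinct_take)
  have split: "take k ?L @ drop k ?L = ?L"
    by simp
  have "sorted_wrt (\<lambda>x y. v x \<ge> v y) (take k ?L @ drop k ?L)"
    using L(3) by simp
  then have le: "v a \<le> v b" if "b \<in> set (take k ?L)" "a \<in> set (drop k ?L)" for a b
    using that unfolding sorted_wrt_append by blast
  have "set (take k ?L) \<union> set (drop k ?L) = E"
    using split L(2) by (metis set_append)
  then show "v a \<le> v b" if "a \<in> E - top_items k rk v E" "b \<in> top_items k rk v E"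
    using that le by (auto simp: top_items_def)
qed

lemma sum_le_top_items:
  assumes "ranking_rule rk" "finite E" "k \<le> card E" and v: "\<And>e. e \<in> E \<Longrightarrow> 0 \<le> v e"
    and A: "A \<subseteq> E" "card A \<le> k"
  shows "sum v A \<le> sum v (top_items k rk v E)"
  using assms top_items_subset[OF assms(1-3), of v] card_top_items[OF assms(1-3), of v]
    top_items_ge[OF assms(1-3), where v = v]
  by (intro sum_le_sum_exchange) (auto intro: finite_subset)

text \<open>The table \<open>t\<close> of answers agrees with \<open>v\<close> only on
  \<open>S\<close>, while \<open>rk\<close> may depend on all of \<open>t\<close>; hence
  \<open>t\<close> ranks and \<open>v\<close> evaluates.\<close>

lemma sum_le_ranked_prefix:
  assumes rk: "ranking_rule rk" and fin: "finite S" and t: "\<And>e. e \<in> S \<Longrightarrow> t e = v e"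
    and v: "\<And>e. e \<in> S \<Longrightarrow> 0 \<le> v e" and A: "A \<subseteq> S"
  shows "sum v A \<le> (\<Sum>i<card A. v (rk t S ! i))"
proof -
  let ?L = "rk t S"
  have L: "distinct ?L" "set ?L = S"
    using rk fin by (auto simp: ranking_rule_def)
  have card: "card A \<le> card S"
    using fin A card_mono by blast
  have len: "length ?L = card S"
    using L distinct_card by metis
  have "sum v A = sum t A"
    using A t by (intro sum.cong) auto
  also have "\<dots> \<le> sum t (top_items (card A) rk t S)"
    using sum_le_top_items[OF rk fin card, of t A] A t v by simp
  also have "\<dots> = (\<Sum>i<card A. t (?L ! i))"
  proof -
    have "take (card A) ?L = map ((!) ?L) [0..<card A]"
      by (rule nth_equalityI) (use card len in auto)
    then have "top_items (card A) rk t S = (!) ?L ` {..<card A}"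
      by (simp add: top_items_def atLeast0LessThan)
    moreover have "inj_on ((!) ?L) {..<card A}"
      using card len L(1) by (intro inj_on_nth) auto
    ultimately show ?thesis
      by (simp add: sum.reindex)
  qed
  also have "\<dots> = (\<Sum>i<card A. v (?L ! i))"
    using card len L(2) by (intro sum.cong refl t) (metis lessThan_iff nth_mem order_less_le_trans)
  finally show ?thesis .
qed

text \<open>The first \<open>card A\<close> positions are worth at least as much as
  \<open>A\<close>, and Chebyshev bounds their contribution at a random rank. Later ranks contribute
  nonnegative amounts and are dropped.\<close>

lemma expected_rank_ge:
  assumes rk: "ranking_rule rk" and fin: "finite S" and t: "\<And>e. e \<in> S \<Longrightarrow> t e = v e"
    and v: "\<And>e. e \<in> S \<Longrightarrow> 0 \<le> v e" and A: "A \<subseteq> S" and s: "(0::real) < s"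
  shows "ennreal (min 1 (s / real (card A)) / s * sum v A) \<le>
    (\<integral>\<^sup>+j. ennreal (v (rk t S ! (j - 1))) \<partial>rank_pmf s)"
proof -
  let ?L = "rk t S" and ?x = "card A"
  have L: "distinct ?L" "set ?L = S" "sorted_wrt (\<lambda>x y. t x \<ge> t y) ?L"
    using rk fin by (auto simp: ranking_rule_def)
  have len: "length ?L = card S"
    using L distinct_card by metis
  have x: "?x \<le> length ?L"
    using fin A card_mono len by metis
  have mem: "?L ! i \<in> S" if "i < ?x" for i
    using that x L(2) by (metis nth_mem order_less_le_trans)
  have anti: "v (?L ! j) \<le> v (?L ! i)" if "i \<le> j" "j < ?x" for i j
  proof (cases "i = j")
    case False
    then have "t (?L ! j) \<le> t (?L ! i)"
      using that x L(3) by (intro sorted_wrt_nth_less[of "\<lambda>x y. t y \<le> t x" ?L i j]) auto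
    then show ?thesis
      using that mem t by simp
  qed simp
  have w: "0 \<le> rank_weight s i" for i
    using s by (simp add: rank_weight_def)
  have "min 1 (s / real ?x) / s * sum v A \<le> min 1 (s / real ?x) / s * (\<Sum>i<?x. v (?L ! i))"
    using s sum_le_ranked_prefix[OF rk fin t v A] by (intro mult_left_mono) auto
  also have "\<dots> \<le> (\<Sum>i<?x. rank_weight s i * v (?L ! i))"
    by (rule rank_weighted_sum_ge[OF s anti])
  finally have "ennreal (min 1 (s / real ?x) / s * sum v A) \<le> ennreal (\<Sum>i<?x. rank_weight s i * v (?L ! i))"
    by (rule ennreal_leI)
  also have "\<dots> = (\<Sum>i<?x. ennreal (v (?L ! i)) * pmf (rank_pmf s) (Suc i))"
    using w v mem
    by (subst sum_ennreal[symmetric]) (auto simp: pmf_rank_pmf_Suc[OF s] ennreal_mult mult.commute intro!: sum.cong)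
  also have "\<dots> = (\<Sum>j\<in>Suc ` {..<?x}. ennreal (v (?L ! (j - 1))) * indicator (Suc ` {..<?x}) j * pmf (rank_pmf s) j)"
    by (simp add: sum.reindex)
  also have "\<dots> = (\<integral>\<^sup>+j. ennreal (v (?L ! (j - 1))) * indicator (Suc ` {..<?x}) j \<partial>rank_pmf s)"
    by (rule nn_integral_measure_pmf_support[symmetric]) auto
  also have "\<dots> \<le> (\<integral>\<^sup>+j. ennreal (v (?L ! (j - 1))) \<partial>rank_pmf s)"
    by (intro nn_integral_mono) (auto simp: indicator_def)
  finally show ?thesis .
qed

text \<open>With \<open>K\<close> the top items, the factor in \<open>expected_rank_ge\<close> for
  \<open>A = S \<inter> K\<close> depends on \<open>S\<close> only through
  \<open>card (S \<inter> K)\<close>. Averaging over \<open>S\<close> therefore spreads it evenly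
  over \<open>K\<close>, leaving the mean of \<open>min X s\<close> for the overlap
  \<open>X\<close>.\<close>

lemma expected_pick_ge:
  fixes t :: "'a set \<Rightarrow> 'a \<Rightarrow> real"
  assumes rk: "ranking_rule rk" and fin: "finite E" and k: "1 \<le> k" "k \<le> card E"
    and m: "1 \<le> m" "m \<le> card E" and s: "s = real k * m / card E"
    and t: "\<And>S e. e \<in> S \<Longrightarrow> t S e = v e" and v: "\<And>e. e \<in> E \<Longrightarrow> 0 \<le> v e"
    and \<delta>: "0 \<le> \<delta>" "m = card E \<or> 1 / (2 * sqrt s) \<le> \<delta>"
  shows "ennreal ((1 - \<delta>) / k * sum v (top_items k rk v E)) \<le>
    (\<integral>\<^sup>+S. \<integral>\<^sup>+j. ennreal (v (rk (t S) S ! (j - 1))) \<partial>rank_pmf s \<partial>pmf_of_set {S. S \<subseteq> E \<and> card S = m})"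
proof -
  let ?SS = "{S. S \<subseteq> E \<and> card S = m}" and ?K = "top_items k rk v E"
  let ?X = "\<lambda>S. real (card (S \<inter> ?K))" and ?g = "\<lambda>S. min 1 (s / real (card (S \<inter> ?K)))"
  have K: "?K \<subseteq> E" "card ?K = k"
    using top_items_subset[OF rk fin k(2)] card_top_items[OF rk fin k(2)] by auto
  have K_ne: "?K \<noteq> {}"
    using K k by auto
  have s_pos: "s > 0"
    using k m unfolding s by simp
  have finSS: "finite ?SS"
    using fin by simp
  have ne: "?SS \<noteq> {}"
    using obtain_subset_with_card_n[OF m(2)] by blast
  define N where "N = real (card ?SS)"
  have N: "N > 0"
    unfolding N_def using finSS ne by (simp add: card_gt_0_iff)
  have min_ge: "(1 - \<delta>) * s * N \<le> (\<Sum>S\<in>?SS. min (?X S) s)"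
  proof (cases "m = card E")
    case True
    \<comment> \<open>The only full sample is \<open>E\<close>, whose overlap is
      \<open>k = s\<close>, so the minimum loses nothing.\<close>
    then have "?SS = {E}"
      using fin card_subset_eq by blast
    moreover have "s = k" "E \<inter> ?K = ?K"
      using True m k K unfolding s by auto
    ultimately show ?thesis
      using \<delta>(1) K(2) by (simp add: N_def algebra_simps)
  next
    case False
    then have "(1 - \<delta>) * (s * N) \<le> (1 - 1 / (2 * sqrt s)) * (s * N)"
      using \<delta> s_pos N by (intro mult_right_mono) auto
    also have "\<dots> \<le> (\<Sum>S\<in>?SS. min (?X S) s)"
      using sum_min_card_Int_subsets[OF fin K(1) K_ne m(1), of s] m False s K(2)
      by (simp add: N_def mult.assoc)
    finally show ?thesis
      by (simp add: mult.assoc)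
  qed
  have sym: "?g (Transposition.transpose a b ` S) = ?g S" if "a \<in> ?K" "b \<in> ?K" for a b S
  proof -
    have "Transposition.transpose a b ` S \<inter> ?K = Transposition.transpose a b ` (S \<inter> ?K)"
      using that by (metis image_Int inj_on_transpose transpose_image_eq)
    then show ?thesis
      by (simp add: card_image)
  qed
  have "k * ((1 - \<delta>) / k * sum v ?K * (s * N)) = sum v ?K * ((1 - \<delta>) * s * N)"
    using k by simp
  also have "\<dots> \<le> sum v ?K * (\<Sum>S\<in>?SS. min (?X S) s)"
    using min_ge v K by (intro mult_left_mono) (auto intro!: sum_nonneg)
  \<comment> \<open>Where the overlap is 0, \<open>?g S * ?X S\<close> is 0, in agreement with
    \<open>min 0 s = 0\<close>.\<close>
  also have "\<dots> = sum v ?K * (\<Sum>S\<in>?SS. ?g S * ?X S)"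
    using s_pos by (intro arg_cong[where f = "\<lambda>x. sum v ?K * x"] sum.cong) (auto simp: min_def field_simps)
  also have "\<dots> = k * (\<Sum>S\<in>?SS. ?g S * sum v (S \<inter> ?K))"
    using symmetric_sum_subsets[OF fin K(1), of ?g v m] sym K(2) by simp
  finally have "(1 - \<delta>) / k * sum v ?K * (s * N) \<le> (\<Sum>S\<in>?SS. ?g S * sum v (S \<inter> ?K))"
    by (rule mult_left_le_imp_le) (use k in simp)
  then have "(1 - \<delta>) / k * sum v ?K \<le> (\<Sum>S\<in>?SS. ?g S / s * sum v (S \<inter> ?K)) / N"
    using s_pos N by (simp add: sum_divide_distrib[symmetric] pos_le_divide_eq mult.assoc)
  then have "ennreal ((1 - \<delta>) / k * sum v ?K) \<le> ennreal ((\<Sum>S\<in>?SS. ?g S / s * sum v (S \<inter> ?K)) / N)"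
    by (rule ennreal_leI)
  also have "\<dots> = (\<Sum>S\<in>?SS. ennreal (?g S / s * sum v (S \<inter> ?K))) / N"
  proof -
    have "0 \<le> ?g S / s * sum v (S \<inter> ?K)" for S
      using s_pos v K(1) by (intro mult_nonneg_nonneg sum_nonneg) auto
    then show ?thesis
      using N by (subst sum_ennreal) (simp_all only: divide_ennreal sum_nonneg)
  qed
  also have "\<dots> \<le> (\<Sum>S\<in>?SS. \<integral>\<^sup>+j. ennreal (v (rk (t S) S ! (j - 1))) \<partial>rank_pmf s) / N"
    using v t by (intro divide_right_mono_ennreal sum_mono expected_rank_ge[OF rk _ _ _ _ s_pos])
      (auto intro: finite_subset[OF _ fin])
  also have "\<dots> = (\<integral>\<^sup>+S. \<integral>\<^sup>+j. ennreal (v (rk (t S) S ! (j - 1))) \<partial>rank_pmf s \<partial>pmf_of_set ?SS)"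
    using finSS ne by (simp add: nn_integral_pmf_of_set N_def ennreal_of_nat_eq_real_of_nat)
  finally show ?thesis .
qed


section \<open>The value of a policy\<close>

lemma cond_pmf_cond_pmf:
  assumes "set_pmf p \<inter> (A \<inter> B) \<noteq> {}"
  shows "cond_pmf (cond_pmf p A) B = cond_pmf p (A \<inter> B)"
proof (rule pmf_eqI)
  fix x
  have A: "set_pmf p \<inter> A \<noteq> {}"
    using assms by blast
  have pos: "measure_pmf.prob p A > 0"
    using A by (auto intro: measure_pmf_posI)
  have AB: "set_pmf (cond_pmf p A) \<inter> B \<noteq> {}"
    using assms A by auto
  have "measure (measure_pmf (cond_pmf p A)) B = measure_pmf.prob p (A \<inter> B) / measure_pmf.prob p A"
    unfolding cond_pmf.rep_eq[OF A]
    by (rule measure_uniform_measure) (use A in \<open>auto simp: emeasure_measure_pmf_not_zero\<close>)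
  then show "pmf (cond_pmf (cond_pmf p A) B) x = pmf (cond_pmf p (A \<inter> B)) x"
    using pos by (simp add: pmf_cond[OF A] pmf_cond[OF AB] pmf_cond[OF assms])
qed

lemma nn_integral_pmf_swap:
  "(\<integral>\<^sup>+x. \<integral>\<^sup>+y. g x y \<partial>measure_pmf B \<partial>measure_pmf A) =
   (\<integral>\<^sup>+y. \<integral>\<^sup>+x. g x y \<partial>measure_pmf A \<partial>measure_pmf B)"
proof -
  have "(\<integral>\<^sup>+z. (case z of (x, y) \<Rightarrow> g x y) \<partial>pair_pmf A B) =
      (\<integral>\<^sup>+z. (case z of (y, x) \<Rightarrow> g x y) \<partial>pair_pmf B A)"
    by (subst pair_commute_pmf) (simp add: case_prod_unfold)
  then show ?thesis
    by (simp add: nn_integral_pair_pmf')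
qed

lemma integrable_cond_pmf:
  fixes h :: "'c \<Rightarrow> real"
  assumes "integrable (measure_pmf p) h" and A: "set_pmf p \<inter> A \<noteq> {}"
  shows "integrable (measure_pmf (cond_pmf p A)) h"
proof -
  have "(\<integral>\<^sup>+x. ennreal (norm (h x)) \<partial>measure_pmf (cond_pmf p A)) =
      (\<integral>\<^sup>+x. ennreal (norm (h x)) * indicator A x \<partial>measure_pmf p) / emeasure (measure_pmf p) A"
    unfolding cond_pmf.rep_eq[OF A] by (rule nn_integral_uniform_measure) auto
  also have "\<dots> < \<infinity>"
  proof -
    have "(\<integral>\<^sup>+x. ennreal (norm (h x)) * indicator A x \<partial>measure_pmf p) \<le>
        (\<integral>\<^sup>+x. ennreal (norm (h x)) \<partial>measure_pmf p)"
      by (intro nn_integral_mono) (auto simp: indicator_def)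
    also have "\<dots> < \<infinity>"
      using assms(1) by (simp add: integrable_iff_bounded)
    finally show ?thesis
      using emeasure_measure_pmf_not_zero[OF A]
      by (auto simp: ennreal_divide_eq_top_iff less_top[symmetric])
  qed
  finally show ?thesis
    by (intro integrableI_bounded) auto
qed

text \<open>The item \<open>e\<close> may already lie in \<open>dom \<psi>\<close>; consistency of
  \<open>\<phi>\<close> then ensures that the update changes nothing instead of overwriting a
  different state.\<close>

lemma consistent_upd:
  assumes "\<phi> \<in> consistent \<psi>"
  shows "consistent (\<psi>(e \<mapsto> \<phi> e)) = consistent \<psi> \<inter> {\<phi>'. \<phi>' e = \<phi> e}"
proof (intro equalityI subsetI)
  fix \<phi>' assume \<phi>': "\<phi>' \<in> consistent (\<psi>(e \<mapsto> \<phi> e))"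
  then have e: "\<phi>' e = \<phi> e"
    by (simp add: consistent_def)
  have "\<psi> e' = Some (\<phi>' e')" if "e' \<in> dom \<psi>" for e'
  proof -
    have "e' \<in> dom (\<psi>(e \<mapsto> \<phi> e))"
      using that by simp
    then have "(\<psi>(e \<mapsto> \<phi> e)) e' = Some (\<phi>' e')"
      using \<phi>' unfolding consistent_def by blast
    moreover have "\<psi> e' = Some (\<phi> e')"
      using that assms unfolding consistent_def by simp
    ultimately show ?thesis
      by (auto split: if_splits)
  qed
  with e show "\<phi>' \<in> consistent \<psi> \<inter> {\<phi>'. \<phi>' e = \<phi> e}"
    by (auto simp: consistent_def)
qed (auto simp: consistent_def)

text \<open>The events of equal state at \<open>e\<close> partition the realizations, so redrawing
  within the class of the drawn realization leaves the posterior unchanged: the tower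
  property.\<close>

lemma bind_cond_pmf_consistent:
  assumes "set_pmf p \<inter> consistent \<psi> \<noteq> {}"
  shows "bind_pmf (cond_pmf p (consistent \<psi>)) (\<lambda>\<phi>. cond_pmf p (consistent (\<psi>(e \<mapsto> \<phi> e)))) =
    cond_pmf p (consistent \<psi>)"
proof -
  let ?q = "cond_pmf p (consistent \<psi>)"
  have "bind_pmf ?q (\<lambda>\<phi>. cond_pmf p (consistent (\<psi>(e \<mapsto> \<phi> e)))) =
      bind_pmf ?q (\<lambda>\<phi>. cond_pmf ?q {\<phi>'. \<phi>' e = \<phi> e})"
  proof (intro bind_pmf_cong refl)
    fix \<phi> assume "\<phi> \<in> set_pmf ?q"
    then show "cond_pmf p (consistent (\<psi>(e \<mapsto> \<phi> e))) = cond_pmf ?q {\<phi>'. \<phi>' e = \<phi> e}"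
      using assms by (subst cond_pmf_cond_pmf) (auto simp: consistent_upd)
  qed
  also have "\<dots> = ?q"
  proof (rule bind_cond_pmf_cancel)
    show "measure (measure_pmf ?q) {\<phi>'. \<phi>' e = \<phi> e} = measure (measure_pmf ?q) {\<phi>''. \<phi>' e = \<phi>'' e}"
      if "\<phi>' e = \<phi> e" for \<phi> \<phi>'
      using that by (intro arg_cong[where f = "measure ?q"]) auto
  qed auto
  finally show ?thesis .
qed

section \<open>Answers and cost of a batch of queries\<close>

lemma set_enum_set: "finite S \<Longrightarrow> distinct (enum_set S) \<and> set (enum_set S) = S"
  unfolding enum_set_def by (rule someI_ex) (metis finite_distinct_list)

lemma policy_of_query_all:
  "policy_of V (query_all xs \<psi> c v) = policy_of V (c (\<lambda>x. if x \<in> set xs then V x \<psi> else v x))"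
  by (induction xs arbitrary: v) (auto intro!: arg_cong[where f = "\<lambda>t. policy_of V (c t)"])

lemma query_count_query_all:
  "query_count V \<phi> (query_all xs \<psi> c v) =
   map_pmf ((+) (length xs)) (query_count V \<phi> (c (\<lambda>x. if x \<in> set xs then V x \<psi> else v x)))"
proof (induction xs arbitrary: v)
  case (Cons x xs)
  have "(\<lambda>y. if y \<in> set xs then V y \<psi> else (v(x := V x \<psi>)) y) =
      (\<lambda>y. if y \<in> set (x # xs) then V y \<psi> else v y)"
    by auto
  then show ?case
    by (simp add: Cons.IH pmf.map_comp o_def del: fun_upd_apply)
next
  case Nil
  have "(+) (0::nat) = id"
    by auto
  then show ?case
    by (simp add: pmf.map_id)
qed

section \<open>Posteriors and the conditional value of a policy\<close>

locale adaptive_utility =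
  fixes E :: "'a set" and St :: "'b set" and p :: "('a \<Rightarrow> 'b) pmf"
    and f :: "'a set \<Rightarrow> ('a \<Rightarrow> 'b) \<Rightarrow> real"
  assumes inst: "stochastic_instance E St p f"
    and submodular: "adaptive_submodular E St p f"
    and monotone: "adaptive_monotone E St p f"
begin

lemma finite_E: "finite E"
  using inst by (simp add: stochastic_instance_def)

lemma supp: "\<phi> \<in> set_pmf p \<Longrightarrow> \<phi> \<in> E \<rightarrow>\<^sub>E St"
  using inst unfolding stochastic_instance_def by (meson subsetD)

lemma f_nonneg: "A \<subseteq> E \<Longrightarrow> \<phi> \<in> set_pmf p \<Longrightarrow> 0 \<le> f A \<phi>"
  using inst supp by (simp add: stochastic_instance_def)

lemma f_integrable: "A \<subseteq> E \<Longrightarrow> integrable (measure_pmf p) (f A)"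
  using inst by (simp add: stochastic_instance_def)

abbreviation "posterior \<psi> \<equiv> cond_pmf p (consistent \<psi>)"
abbreviation "realizable \<equiv> partial_realization E St p"

text \<open>The range condition comes from a support point consistent with \<open>\<psi>\<close>,
  whose states on \<open>E\<close> lie in \<open>St\<close>.\<close>

lemma realizable_iff: "realizable \<psi> \<longleftrightarrow> dom \<psi> \<subseteq> E \<and> set_pmf p \<inter> consistent \<psi> \<noteq> {}"
proof
  assume "realizable \<psi>"
  then show "dom \<psi> \<subseteq> E \<and> set_pmf p \<inter> consistent \<psi> \<noteq> {}"
    unfolding partial_realization_def
    by (metis less_irrefl measure_Int_set_pmf measure_empty inf_commute)
next
  assume *: "dom \<psi> \<subseteq> E \<and> set_pmf p \<inter> consistent \<psi> \<noteq> {}"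
  then obtain \<phi> where \<phi>: "\<phi> \<in> set_pmf p" "\<phi> \<in> consistent \<psi>"
    by blast
  have "ran \<psi> \<subseteq> St"
  proof
    fix st assume "st \<in> ran \<psi>"
    then obtain e where "\<psi> e = Some st"
      by (auto simp: ran_def)
    moreover from this have "e \<in> E" "\<phi> e = st"
      using * \<phi>(2) by (auto simp: consistent_def dom_def)
    ultimately show "st \<in> St"
      using supp[OF \<phi>(1)] by (auto simp: PiE_iff)
  qed
  then show "realizable \<psi>"
    using * \<phi> by (auto simp: partial_realization_def intro: measure_pmf_posI)
qed

lemma realizable_empty: "realizable Map.empty"
  by (auto simp: realizable_iff consistent_def set_pmf_not_empty)

lemma set_posterior:
  "realizable \<psi> \<Longrightarrow> set_pmf (posterior \<psi>) = set_pmf p \<inter> consistent \<psi>"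
  by (simp add: realizable_iff)

lemma realizable_upd:
  assumes "realizable \<psi>" "e \<in> E" "\<phi> \<in> set_pmf (posterior \<psi>)"
  shows "realizable (\<psi>(e \<mapsto> \<phi> e))"
  using assms by (auto simp: realizable_iff set_posterior consistent_upd)

text \<open>Integrals are taken in \<open>ennreal\<close>, so that no integrability conditions arise along the
  infinitely branching policy trees.\<close>

definition val :: "('a set \<Rightarrow> ('a \<Rightarrow> 'b) \<Rightarrow> ennreal) \<Rightarrow> ('a \<rightharpoonup> 'b) \<Rightarrow> ('a, 'b) policy \<Rightarrow> ennreal" where
  "val h \<psi> \<pi> = (\<integral>\<^sup>+\<phi>. \<integral>\<^sup>+A. h (dom \<psi> \<union> A) \<phi> \<partial>selected \<phi> \<pi> \<partial>posterior \<psi>)"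

lemma val_Stop: "val h \<psi> Stop = (\<integral>\<^sup>+\<phi>. h (dom \<psi>) \<phi> \<partial>posterior \<psi>)"
  by (simp add: val_def)

text \<open>A selection whose outcome is ignored becomes a change of the utility, so it commutes
  with later observations; this is one reason for the parameter \<open>h\<close>.\<close>

lemma val_Select_insert: "val h \<psi> (Select e (\<lambda>_. \<pi>)) = val (\<lambda>A. h (insert e A)) \<psi> \<pi>"
  by (simp add: val_def)

lemma val_Flip: "val h \<psi> (Flip P) = (\<integral>\<^sup>+\<pi>. val h \<psi> \<pi> \<partial>P)"
  unfolding val_def by (subst nn_integral_pmf_swap) (simp add: join_pmf_def)

text \<open>By the tower property the realization may be redrawn after \<open>e\<close> is observed.
  All redrawn realizations share the state \<open>\<phi> e\<close>, so the single continuation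
  \<open>c (\<phi> e)\<close> applies to them.\<close>

lemma val_Select:
  assumes "realizable \<psi>"
  shows "val h \<psi> (Select e c) = (\<integral>\<^sup>+\<phi>. val h (\<psi>(e \<mapsto> \<phi> e)) (c (\<phi> e)) \<partial>posterior \<psi>)"
proof -
  let ?g = "\<lambda>\<phi>. \<integral>\<^sup>+A. h (dom \<psi> \<union> insert e A) \<phi> \<partial>selected \<phi> (c (\<phi> e))"
  have ne: "set_pmf p \<inter> consistent \<psi> \<noteq> {}"
    using assms realizable_iff by blast
  have "val h \<psi> (Select e c) = (\<integral>\<^sup>+\<phi>. ?g \<phi> \<partial>posterior \<psi>)"
    by (simp add: val_def)
  also have "\<dots> = (\<integral>\<^sup>+\<phi>. \<integral>\<^sup>+\<phi>'. ?g \<phi>' \<partial>posterior (\<psi>(e \<mapsto> \<phi> e)) \<partial>posterior \<psi>)"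
    by (subst bind_cond_pmf_consistent[OF ne, symmetric, of e]) (rule nn_integral_bind_pmf)
  also have "\<dots> = (\<integral>\<^sup>+\<phi>. val h (\<psi>(e \<mapsto> \<phi> e)) (c (\<phi> e)) \<partial>posterior \<psi>)"
  proof (intro nn_integral_cong_AE AE_pmfI)
    fix \<phi> assume \<phi>: "\<phi> \<in> set_pmf (posterior \<psi>)"
    then have \<phi>': "\<phi> \<in> set_pmf p" "\<phi> \<in> consistent \<psi>"
      using set_posterior[OF assms] by auto
    have "set_pmf p \<inter> consistent (\<psi>(e \<mapsto> \<phi> e)) \<noteq> {}"
      using \<phi>' by (auto simp: consistent_upd)
    then have eq: "\<phi>' e = \<phi> e" if "\<phi>' \<in> set_pmf (posterior (\<psi>(e \<mapsto> \<phi> e)))" for \<phi>'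
      using that \<phi>' by (simp add: consistent_upd)
    show "(\<integral>\<^sup>+\<phi>'. ?g \<phi>' \<partial>posterior (\<psi>(e \<mapsto> \<phi> e))) = val h (\<psi>(e \<mapsto> \<phi> e)) (c (\<phi> e))"
      unfolding val_def
    proof (intro nn_integral_cong_AE AE_pmfI)
      fix \<phi>' assume "\<phi>' \<in> set_pmf (posterior (\<psi>(e \<mapsto> \<phi> e)))"
      then have "\<phi>' e = \<phi> e"
        by (rule eq)
      then show "?g \<phi>' = (\<integral>\<^sup>+A. h (dom (\<psi>(e \<mapsto> \<phi> e)) \<union> A) \<phi>' \<partial>selected \<phi>' (c (\<phi> e)))"
        by simp
    qed
  qed
  finally show ?thesis .
qed

text \<open>Restricting to realizations consistent with \<open>\<psi>\<close> lets the property pass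
  to subtrees: a branch is constrained only for realizations having the observed state.\<close>

definition selects_in_E :: "('a \<rightharpoonup> 'b) \<Rightarrow> ('a, 'b) policy \<Rightarrow> bool" where
  "selects_in_E \<psi> \<pi> \<longleftrightarrow> (\<forall>\<phi>\<in>set_pmf p \<inter> consistent \<psi>. \<forall>A\<in>set_pmf (selected \<phi> \<pi>). A \<subseteq> E)"

lemma selects_in_E_feasible: "feasible E St k \<pi> \<Longrightarrow> selects_in_E \<psi> \<pi>"
  using supp unfolding selects_in_E_def feasible_def by blast

lemma selects_in_E_Select:
  assumes "realizable \<psi>" "selects_in_E \<psi> (Select e c)"
  shows "e \<in> E" "\<phi> \<in> set_pmf (posterior \<psi>) \<Longrightarrow> selects_in_E (\<psi>(e \<mapsto> \<phi> e)) (c (\<phi> e))"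
proof -
  obtain \<phi> where \<phi>: "\<phi> \<in> set_pmf p" "\<phi> \<in> consistent \<psi>"
    using assms(1) by (auto simp: realizable_iff)
  obtain A where "A \<in> set_pmf (selected \<phi> (c (\<phi> e)))"
    using set_pmf_not_empty[of "selected \<phi> (c (\<phi> e))"] by blast
  then have "insert e A \<in> set_pmf (selected \<phi> (Select e c))"
    by simp
  then have "insert e A \<subseteq> E"
    using assms(2) \<phi> unfolding selects_in_E_def by blast
  then show "e \<in> E"
    by simp
  show "selects_in_E (\<psi>(e \<mapsto> \<phi> e)) (c (\<phi> e))" if "\<phi> \<in> set_pmf (posterior \<psi>)" for \<phi>
    unfolding selects_in_E_def
  proof (intro ballI)
    fix \<phi>' A assume \<phi>': "\<phi>' \<in> set_pmf p \<inter> consistent (\<psi>(e \<mapsto> \<phi> e))"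
      and A: "A \<in> set_pmf (selected \<phi>' (c (\<phi> e)))"
    have "\<phi> \<in> consistent \<psi>"
      using that set_posterior[OF assms(1)] by simp
    then have "\<phi>' \<in> set_pmf p \<inter> consistent \<psi>" "\<phi>' e = \<phi> e"
      using \<phi>' by (simp_all add: consistent_upd)
    moreover have "insert e A \<in> set_pmf (selected \<phi>' (Select e c))"
      using A \<open>\<phi>' e = \<phi> e\<close> by simp
    ultimately have "insert e A \<subseteq> E"
      using assms(2) unfolding selects_in_E_def by blast
    then show "A \<subseteq> E"
      by simp
  qed
qed

lemma selects_in_E_Flip: "selects_in_E \<psi> (Flip P) \<Longrightarrow> \<pi> \<in> set_pmf P \<Longrightarrow> selects_in_E \<psi> \<pi>"
  by (simp add: selects_in_E_def join_pmf_def)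

section \<open>Monotonicity and submodularity for whole policies\<close>

abbreviation "F A \<phi> \<equiv> ennreal (f A \<phi>)"

lemma marginal_nonneg: "realizable \<psi> \<Longrightarrow> e \<in> E \<Longrightarrow> 0 \<le> marginal p f e \<psi>"
  using monotone by (auto simp: adaptive_monotone_def)

lemma nn_integral_posterior:
  assumes "realizable \<psi>" "A \<subseteq> E"
  shows "(\<integral>\<^sup>+\<phi>. F A \<phi> \<partial>posterior \<psi>) = ennreal (measure_pmf.expectation (posterior \<psi>) (f A))"
    and "0 \<le> measure_pmf.expectation (posterior \<psi>) (f A)"
proof -
  have "integrable (posterior \<psi>) (f A)"
    using assms by (auto intro: integrable_cond_pmf f_integrable simp: realizable_iff)
  moreover have AE: "AE \<phi> in posterior \<psi>. 0 \<le> f A \<phi>"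
    using assms by (intro AE_pmfI) (auto simp: set_posterior intro: f_nonneg)
  ultimately show "(\<integral>\<^sup>+\<phi>. F A \<phi> \<partial>posterior \<psi>) = ennreal (measure_pmf.expectation (posterior \<psi>) (f A))"
    by (rule nn_integral_eq_integral)
  show "0 \<le> measure_pmf.expectation (posterior \<psi>) (f A)"
    by (rule integral_nonneg_AE[OF AE])
qed

text \<open>Adaptive monotonicity makes the difference of the two expectations nonnegative, so
  \<open>ennreal\<close> does not truncate it.\<close>

lemma val_Select_Stop:
  assumes "realizable \<psi>" "e \<in> E"
  shows "val F \<psi> (Select e (\<lambda>_. Stop)) = val F \<psi> Stop + ennreal (marginal p f e \<psi>)"
proof -
  have dom: "dom \<psi> \<subseteq> E" and ne: "set_pmf p \<inter> consistent \<psi> \<noteq> {}"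
    using assms realizable_iff by auto
  have "marginal p f e \<psi> = measure_pmf.expectation (posterior \<psi>) (f (insert e (dom \<psi>))) -
      measure_pmf.expectation (posterior \<psi>) (f (dom \<psi>))"
    unfolding marginal_def using dom assms ne
    by (subst Bochner_Integration.integral_diff) (auto intro!: integrable_cond_pmf f_integrable)
  then show ?thesis
    using nn_integral_posterior[OF assms(1), of "dom \<psi>"] nn_integral_posterior[OF assms(1), of "insert e (dom \<psi>)"]
      marginal_nonneg[OF assms] dom assms(2)
    by (simp add: val_Select_insert val_Stop ennreal_plus[symmetric] del: ennreal_plus)
qed

text \<open>The state of the extra item \<open>e\<close> is ignored, so its selection can be pushed
  down the tree to the leaves, where adaptive monotonicity applies to the partial realization
  reached.\<close>

lemma val_le_val_Select:
  assumes "realizable \<psi>" "e \<in> E" "selects_in_E \<psi> \<pi>"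
  shows "val F \<psi> \<pi> \<le> val F \<psi> (Select e (\<lambda>_. \<pi>))"
  using assms(1,3)
proof (induction \<pi> arbitrary: \<psi>)
  case Stop
  then show ?case
    using val_Select_Stop[OF _ assms(2)] by simp
next
  case (Select e' c)
  note sel = selects_in_E_Select[OF Select.prems]
  have "val F \<psi> (Select e' c) = (\<integral>\<^sup>+\<phi>. val F (\<psi>(e' \<mapsto> \<phi> e')) (c (\<phi> e')) \<partial>posterior \<psi>)"
    using Select.prems by (simp add: val_Select)
  also have "\<dots> \<le> (\<integral>\<^sup>+\<phi>. val F (\<psi>(e' \<mapsto> \<phi> e')) (Select e (\<lambda>_. c (\<phi> e'))) \<partial>posterior \<psi>)"
  proof (intro nn_integral_mono_AE AE_pmfI)
    fix \<phi> assume \<phi>: "\<phi> \<in> set_pmf (posterior \<psi>)"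
    show "val F (\<psi>(e' \<mapsto> \<phi> e')) (c (\<phi> e')) \<le> val F (\<psi>(e' \<mapsto> \<phi> e')) (Select e (\<lambda>_. c (\<phi> e')))"
      by (rule Select.IH[OF rangeI realizable_upd[OF Select.prems(1) sel(1) \<phi>] sel(2)[OF \<phi>]])
  qed
  \<comment> \<open>Both sides unfold to the tree of \<open>e'\<close> evaluated with
    \<open>e\<close> inserted into every selected set.\<close>
  also have "\<dots> = val F \<psi> (Select e (\<lambda>_. Select e' c))"
    using Select.prems by (simp add: val_Select val_Select_insert)
  finally show ?case .
next
  case (Flip P)
  have "val F \<psi> (Flip P) \<le> (\<integral>\<^sup>+\<pi>. val F \<psi> (Select e (\<lambda>_. \<pi>)) \<partial>P)"
    unfolding val_Flip using Flip by (intro nn_integral_mono_AE AE_pmfI) (auto dest: selects_in_E_Flip)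
  also have "\<dots> = val F \<psi> (Select e (\<lambda>_. Flip P))"
    by (simp add: val_Flip val_Select_insert)
  finally show ?case .
qed

text \<open>\<open>val\<close> evaluates \<open>sum d\<close> at the union with \<open>dom \<psi>\<close>, so \<open>sum d (dom \<psi>)\<close> is added on the left.
  A term for the new items alone would have to discount items that \<open>\<pi>\<close> selects twice.\<close>

lemma val_submodular:
  assumes \<psi>0: "realizable \<psi>0" and "\<psi>0 \<subseteq>\<^sub>m \<psi>" "realizable \<psi>" "selects_in_E \<psi> \<pi>"
  defines "d \<equiv> \<lambda>e. ennreal (marginal p f e \<psi>0)"
  shows "val F \<psi> \<pi> + sum d (dom \<psi>) \<le> val F \<psi> Stop + val (\<lambda>A _. sum d A) \<psi> \<pi>"
  using assms(2-4)
proof (induction \<pi> arbitrary: \<psi>)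
  case Stop
  then show ?case
    by (simp add: val_Stop)
next
  case (Select e c)
  note sel = selects_in_E_Select[OF Select.prems(2,3)]
  have fin: "finite (dom \<psi>)"
    using Select.prems(2) finite_E finite_subset by (auto simp: realizable_iff)
  have sub: "\<psi>0 \<subseteq>\<^sub>m \<psi>(e \<mapsto> \<phi> e)" if "\<phi> \<in> set_pmf (posterior \<psi>)" for \<phi>
    using that Select.prems set_posterior[OF Select.prems(2)]
    by (fastforce simp: map_le_def consistent_def dom_def)
  \<comment> \<open>Every branch enlarges the domain by the same item \<open>e\<close>, so the
    offset is constant under the integral over the observed state.\<close>
  have "val F \<psi> (Select e c) + sum d (insert e (dom \<psi>)) =
      (\<integral>\<^sup>+\<phi>. val F (\<psi>(e \<mapsto> \<phi> e)) (c (\<phi> e)) + sum d (dom (\<psi>(e \<mapsto> \<phi> e))) \<partial>posterior \<psi>)"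
    using Select.prems(2) by (simp add: val_Select nn_integral_add)
  also have "\<dots> \<le> (\<integral>\<^sup>+\<phi>. val F (\<psi>(e \<mapsto> \<phi> e)) Stop + val (\<lambda>A _. sum d A) (\<psi>(e \<mapsto> \<phi> e)) (c (\<phi> e)) \<partial>posterior \<psi>)"
  proof (intro nn_integral_mono_AE AE_pmfI)
    fix \<phi> assume \<phi>: "\<phi> \<in> set_pmf (posterior \<psi>)"
    show "val F (\<psi>(e \<mapsto> \<phi> e)) (c (\<phi> e)) + sum d (dom (\<psi>(e \<mapsto> \<phi> e))) \<le>
        val F (\<psi>(e \<mapsto> \<phi> e)) Stop + val (\<lambda>A _. sum d A) (\<psi>(e \<mapsto> \<phi> e)) (c (\<phi> e))"
      by (rule Select.IH[OF rangeI sub[OF \<phi>] realizable_upd[OF Select.prems(2) sel(1) \<phi>] sel(2)[OF \<phi>]])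
  qed
  also have "\<dots> = val F \<psi> (Select e (\<lambda>_. Stop)) + val (\<lambda>A _. sum d A) \<psi> (Select e c)"
    using Select.prems(2) by (simp add: val_Select[of \<psi>] nn_integral_add)
  finally have *: "val F \<psi> (Select e c) + sum d (insert e (dom \<psi>)) \<le>
      val F \<psi> (Select e (\<lambda>_. Stop)) + val (\<lambda>A _. sum d A) \<psi> (Select e c)" .
  show ?case
  \<comment> \<open>Reselecting an item gains nothing. A new item gains at most \<open>d e\<close>,
    by submodularity relative to the fixed \<open>\<psi>0\<close>, and the finite \<open>d e\<close>
    cancels.\<close>
  proof (cases "e \<in> dom \<psi>")
    case True
    then show ?thesis
      using * by (simp add: insert_absorb val_Select_insert val_Stop)
  next
    case False
    then have "marginal p f e \<psi> \<le> marginal p f e \<psi>0"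
      using submodular Select.prems \<psi>0 sel(1) by (auto simp: adaptive_submodular_def)
    then have "val F \<psi> (Select e (\<lambda>_. Stop)) \<le> val F \<psi> Stop + d e"
      unfolding val_Select_Stop[OF Select.prems(2) sel(1)] d_def
      by (intro add_left_mono ennreal_leI)
    then have "val F \<psi> (Select e c) + sum d (insert e (dom \<psi>)) \<le>
        val F \<psi> Stop + d e + val (\<lambda>A _. sum d A) \<psi> (Select e c)"
      by (intro order_trans[OF *] add_right_mono)
    then have "d e + (val F \<psi> (Select e c) + sum d (dom \<psi>)) \<le>
        d e + (val F \<psi> Stop + val (\<lambda>A _. sum d A) \<psi> (Select e c))"
      using False fin by (simp only: sum.insert ac_simps not_False_eq_True)
    then show ?thesis
      by (simp add: d_def ennreal_add_left_cancel_le)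
  qed
next
  case (Flip P)
  have "val F \<psi> (Flip P) + sum d (dom \<psi>) = (\<integral>\<^sup>+\<pi>. val F \<psi> \<pi> + sum d (dom \<psi>) \<partial>P)"
    by (simp add: val_Flip nn_integral_add)
  also have "\<dots> \<le> (\<integral>\<^sup>+\<pi>. val F \<psi> Stop + val (\<lambda>A _. sum d A) \<psi> \<pi> \<partial>P)"
    using Flip by (intro nn_integral_mono_AE AE_pmfI) (auto dest: selects_in_E_Flip)
  also have "\<dots> = val F \<psi> Stop + val (\<lambda>A _. sum d A) \<psi> (Flip P)"
    by (simp add: val_Flip nn_integral_add)
  finally show ?case .
qed

text \<open>Marginal utilities are frozen at \<open>\<psi>\<close> itself. A run selects at most
  \<open>k\<close> items, whose frozen marginals total at most \<open>T\<close>; the finite offset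
  \<open>sum d (dom \<psi>)\<close> then cancels.\<close>

lemma val_feasible_le:
  assumes \<psi>: "realizable \<psi>" and feas: "feasible E St k \<pi>"
    and T: "\<And>A. A \<subseteq> E \<Longrightarrow> card A \<le> k \<Longrightarrow> (\<Sum>e\<in>A. marginal p f e \<psi>) \<le> T"
  shows "val F \<psi> \<pi> \<le> val F \<psi> Stop + ennreal T"
proof -
  define d where "d = (\<lambda>e. ennreal (marginal p f e \<psi>))"
  have dom: "dom \<psi> \<subseteq> E"
    using \<psi> realizable_iff by blast
  have "val (\<lambda>A _. sum d A) \<psi> \<pi> \<le> (\<integral>\<^sup>+\<phi>. \<integral>\<^sup>+A. sum d (dom \<psi>) + ennreal T \<partial>selected \<phi> \<pi> \<partial>posterior \<psi>)"
    unfolding val_def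
  proof (intro nn_integral_mono_AE AE_pmfI)
    fix \<phi> A assume "\<phi> \<in> set_pmf (posterior \<psi>)" and A: "A \<in> set_pmf (selected \<phi> \<pi>)"
    then have A: "A \<subseteq> E" "card A \<le> k"
      using feas supp[of \<phi>] by (auto simp: feasible_def set_posterior[OF \<psi>])
    \<comment> \<open>Items of \<open>A\<close> already in \<open>dom \<psi>\<close> get counted
      twice on the right, which only weakens the bound.\<close>
    have "sum d (dom \<psi> \<union> A) \<le> sum d (dom \<psi> \<union> A) + sum d (dom \<psi> \<inter> A)"
      by simp
    also have "\<dots> = sum d (dom \<psi>) + sum d A"
      using A(1) dom finite_E by (intro sum.union_inter) (auto intro: finite_subset)
    also have "sum d A = ennreal (\<Sum>e\<in>A. marginal p f e \<psi>)"
      unfolding d_def using A(1) \<psi> by (intro sum_ennreal) (auto intro: marginal_nonneg)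
    also have "\<dots> \<le> ennreal T"
      using A by (intro ennreal_leI T)
    finally show "sum d (dom \<psi> \<union> A) \<le> sum d (dom \<psi>) + ennreal T"
      by simp
  qed
  also have "\<dots> = sum d (dom \<psi>) + ennreal T"
    by simp
  finally have "val F \<psi> Stop + val (\<lambda>A _. sum d A) \<psi> \<pi> \<le> val F \<psi> Stop + (sum d (dom \<psi>) + ennreal T)"
    by (rule add_left_mono)
  with val_submodular[OF \<psi> map_le_refl \<psi> selects_in_E_feasible[OF feas]]
  have "val F \<psi> \<pi> + sum d (dom \<psi>) \<le> val F \<psi> Stop + (sum d (dom \<psi>) + ennreal T)"
    unfolding d_def[symmetric] by (rule order_trans)
  then have "sum d (dom \<psi>) + val F \<psi> \<pi> \<le> sum d (dom \<psi>) + (val F \<psi> Stop + ennreal T)"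
    by (simp only: ac_simps)
  moreover have "sum d (dom \<psi>) \<noteq> \<infinity>"
    by (simp add: d_def finite_subset[OF dom finite_E])
  ultimately show ?thesis
    by (simp add: ennreal_add_left_cancel_le)
qed

text \<open>A Bochner integral that does not exist is 0, so finiteness has to be shown. Only subsets
  of the finite set \<open>E\<close> are selected, and the sum of \<open>f\<close> over all of them
  is an integrable bound.\<close>

lemma f_avg_eq:
  assumes "selects_in_E Map.empty \<pi>"
  shows "ennreal (f_avg p f \<pi>) = val F Map.empty \<pi>"
proof -
  have post: "posterior Map.empty = p"
    by (rule pmf_eqI) (simp add: consistent_def pmf_cond set_pmf_not_empty)
  have sel: "A \<subseteq> E" if "\<phi> \<in> set_pmf p" "A \<in> set_pmf (selected \<phi> \<pi>)" for \<phi> A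
    using assms that by (auto simp: selects_in_E_def consistent_def)
  let ?I = "\<lambda>\<phi>. measure_pmf.expectation (selected \<phi> \<pi>) (\<lambda>A. f A \<phi>)"
  have nonneg: "AE A in selected \<phi> \<pi>. 0 \<le> f A \<phi>" if "\<phi> \<in> set_pmf p" for \<phi>
    using that sel by (intro AE_pmfI f_nonneg) auto
  have "ennreal (?I \<phi>) = (\<integral>\<^sup>+A. F A \<phi> \<partial>selected \<phi> \<pi>)" if "\<phi> \<in> set_pmf p" for \<phi>
  proof -
    have "finite (set_pmf (selected \<phi> \<pi>))"
      by (rule finite_subset[of _ "Pow E"]) (use sel[OF that] finite_E in blast)+
    then have "integrable (selected \<phi> \<pi>) (\<lambda>A. f A \<phi>)"
      by (rule integrable_measure_pmf_finite)
    then show ?thesis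
      using nonneg[OF that] by (rule nn_integral_eq_integral[symmetric])
  qed
  then have eq: "val F Map.empty \<pi> = (\<integral>\<^sup>+\<phi>. ennreal (?I \<phi>) \<partial>p)"
    unfolding val_def post by (intro nn_integral_cong_AE AE_pmfI) simp
  have "val F Map.empty \<pi> \<le> (\<integral>\<^sup>+\<phi>. \<integral>\<^sup>+A. (\<Sum>B\<in>Pow E. F B \<phi>) \<partial>selected \<phi> \<pi> \<partial>p)"
    unfolding val_def post
  proof (intro nn_integral_mono_AE AE_pmfI)
    fix \<phi> A assume "\<phi> \<in> set_pmf p" "A \<in> set_pmf (selected \<phi> \<pi>)"
    then have "dom Map.empty \<union> A \<in> Pow E"
      using sel by simp
    then show "F (dom Map.empty \<union> A) \<phi> \<le> (\<Sum>B\<in>Pow E. F B \<phi>)"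
      using finite_E by (intro member_le_sum) auto
  qed
  also have "\<dots> = (\<Sum>B\<in>Pow E. \<integral>\<^sup>+\<phi>. F B \<phi> \<partial>p)"
    by (simp add: nn_integral_sum)
  also have "\<dots> < \<infinity>"
  proof -
    have "(\<integral>\<^sup>+\<phi>. F B \<phi> \<partial>p) < \<infinity>" if "B \<subseteq> E" for B
      using nn_integral_posterior(1)[OF realizable_empty that] by (simp add: post)
    then show ?thesis
      using finite_E by (auto simp: less_top[symmetric])
  qed
  finally have "val F Map.empty \<pi> < \<infinity>" .
  moreover have "f_avg p f \<pi> = enn2real (\<integral>\<^sup>+\<phi>. ennreal (?I \<phi>) \<partial>p)"
    unfolding f_avg_def
    by (rule integral_eq_nn_integral) (auto intro!: AE_pmfI integral_nonneg_AE nonneg)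
  ultimately show ?thesis
    by (simp add: eq less_top[symmetric])
qed

end


section \<open>The linear-time policy\<close>

text \<open>First \<open>1 + x \<le> exp x\<close> bounds the power by
  \<open>exp (- (1 - d))\<close>; then the chord of \<open>exp\<close> between -1 and 0 makes the
  bound linear in \<open>d\<close>.\<close>

lemma one_minus_power_ge:
  assumes k: "1 \<le> k" and d: "0 \<le> d" "d \<le> 1"
  shows "(1 - 1 / exp 1) * (1 - d) \<le> 1 - (1 - (1 - d) / real k) ^ k"
proof -
  have "(1 - (1 - d) / real k) ^ k \<le> exp (- ((1 - d) / k)) ^ k"
    using k d exp_ge_add_one_self[of "- ((1 - d) / k)"] by (intro power_mono) (auto simp: field_simps)
  also have "\<dots> = exp (- (1 - d))"
    using k by (simp add: exp_of_nat_mult[symmetric])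
  also have "\<dots> \<le> (1 - (1 - d)) * exp 0 + (1 - d) * exp (- 1)"
    using convex_onD[OF exp_convex, of "1 - d" 0 "-1"] d by simp
  finally show ?thesis
    by (simp add: exp_minus field_simps)
qed

text \<open>Here \<open>V\<close> is the current value, \<open>W\<close> the value compared with,
  \<open>G\<close> the gain of a round and \<open>c\<close> the share of the gap left open by the
  rounds after it. As subtraction truncates on \<open>ennreal\<close>, coefficients are split into
  sums: \<open>1 - c * (1 - a) = (1 - c) + c * a\<close> and
  \<open>c = c * a + c * (1 - a)\<close>.\<close>

lemma greedy_step_ennreal:
  fixes V W G :: ennreal
  assumes a: "0 \<le> a" "a \<le> 1" and c: "0 \<le> c" "c \<le> 1" and T: "0 \<le> T"
    and W: "W \<le> V + ennreal T" and G: "ennreal (a * T) \<le> G"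
  shows "ennreal (1 - c * (1 - a)) * W + ennreal (c * (1 - a)) * V \<le>
    ennreal (1 - c) * W + ennreal c * (V + G)"
proof -
  have "ennreal (1 - c * (1 - a)) = ennreal (1 - c) + ennreal (c * a)"
    using a c by (simp add: ennreal_plus[symmetric] algebra_simps del: ennreal_plus)
  moreover have "ennreal (c * a) * W \<le> ennreal (c * a) * V + ennreal c * ennreal (a * T)"
    using mult_left_mono[OF W, of "ennreal (c * a)"] a c T
    by (simp add: distrib_left ennreal_mult[symmetric] mult.assoc)
  moreover have "ennreal c * ennreal (a * T) \<le> ennreal c * G"
    by (intro mult_left_mono G) simp
  moreover have "ennreal c = ennreal (c * a) + ennreal (c * (1 - a))"
    using ennreal_plus[of "c * a" "c * (1 - a)"] a c by (simp add: distrib_left[symmetric])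
  ultimately have "ennreal (1 - c * (1 - a)) * W + ennreal (c * (1 - a)) * V \<le>
      ennreal (1 - c) * W + (ennreal (c * a) * V + ennreal c * G) + ennreal (c * (1 - a)) * V"
    by (simp add: distrib_right add.assoc) (meson add_left_mono add_right_mono order_trans)
  also have "\<dots> = ennreal (1 - c) * W + ((ennreal (c * a) + ennreal (c * (1 - a))) * V + ennreal c * G)"
    by (simp add: distrib_left distrib_right ac_simps)
  finally show ?thesis
    using \<open>ennreal c = ennreal (c * a) + ennreal (c * (1 - a))\<close> by (simp add: distrib_left)
qed

context adaptive_utility
begin

section \<open>Guarantee of the linear-time policy\<close>

abbreviation "lt r m s rk \<psi> \<equiv> policy_of (marginal p f) (lt_rounds r E m s rk \<psi>)"

text \<open>The answers of one round; 0 off \<open>S\<close> is the value of the initial table in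
  \<open>lt_rounds\<close>.\<close>

definition table :: "('a \<rightharpoonup> 'b) \<Rightarrow> 'a set \<Rightarrow> 'a \<Rightarrow> real" where
  "table \<psi> S = (\<lambda>x. if x \<in> S then marginal p f x \<psi> else 0)"

text \<open>By adaptive monotonicity the test \<open>v e \<ge> 0\<close> succeeds at every
  realizable \<open>\<psi>\<close>, so each round does select an item.\<close>

lemma lt_Suc:
  assumes \<psi>: "realizable \<psi>" and rk: "ranking_rule rk" and m: "m \<le> card E" and s: "0 < s" "s \<le> real m"
  shows "lt (Suc r) m s rk \<psi> = Flip (map_pmf
    (\<lambda>(S, j). Select (rk (table \<psi> S) S ! (j - 1)) (\<lambda>st. lt r m s rk (\<psi>(rk (table \<psi> S) S ! (j - 1) \<mapsto> st))))
    (pair_pmf (pmf_of_set {S. S \<subseteq> E \<and> card S = m}) (rank_pmf s)))"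
    and pick_in_E: "S \<subseteq> E \<Longrightarrow> card S = m \<Longrightarrow> j \<in> set_pmf (rank_pmf s) \<Longrightarrow> rk (table \<psi> S) S ! (j - 1) \<in> S"
proof -
  let ?SS = "{S. S \<subseteq> E \<and> card S = m}"
  have pick: "rk (table \<psi> S) S ! (j - 1) \<in> S" if "S \<subseteq> E" "card S = m" "j \<in> set_pmf (rank_pmf s)" for S j
  proof -
    let ?L = "rk (table \<psi> S) S"
    have "finite S"
      using that(1) finite_E finite_subset by blast
    then have L: "distinct ?L" "set ?L = S"
      using rk by (auto simp: ranking_rule_def)
    then have "length ?L = m"
      using that(2) distinct_card by metis
    then have "j - 1 < length ?L"
      using set_pmf_rank_pmf[OF s that(3)] by simp
    then show ?thesis
      using L(2) nth_mem by blast
  qed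
  then show "S \<subseteq> E \<Longrightarrow> card S = m \<Longrightarrow> j \<in> set_pmf (rank_pmf s) \<Longrightarrow> rk (table \<psi> S) S ! (j - 1) \<in> S" .
  have ne: "?SS \<noteq> {}" "finite ?SS"
    using obtain_subset_with_card_n[OF m] finite_E by auto
  show "lt (Suc r) m s rk \<psi> = Flip (map_pmf
    (\<lambda>(S, j). Select (rk (table \<psi> S) S ! (j - 1)) (\<lambda>st. lt r m s rk (\<psi>(rk (table \<psi> S) S ! (j - 1) \<mapsto> st))))
    (pair_pmf (pmf_of_set ?SS) (rank_pmf s)))"
    unfolding lt_rounds.simps policy_of.simps pmf.map_comp
  proof (intro arg_cong[where f = Flip] map_pmf_cong refl)
    fix z assume "z \<in> set_pmf (pair_pmf (pmf_of_set ?SS) (rank_pmf s))"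
    then have "z \<in> ?SS \<times> set_pmf (rank_pmf s)"
      using ne by simp
    then obtain S j where z: "z = (S, j)" and S: "S \<subseteq> E" "card S = m" and j: "j \<in> set_pmf (rank_pmf s)"
      by blast
    let ?e = "rk (table \<psi> S) S ! (j - 1)"
    have "?e \<in> S"
      using pick[OF S j] .
    then have nonneg: "0 \<le> table \<psi> S ?e"
      using S(1) marginal_nonneg[OF \<psi>] unfolding table_def by auto
    have "finite S"
      using S(1) finite_E finite_subset by blast
    then have "(\<lambda>x. if x \<in> set (enum_set S) then marginal p f x \<psi> else 0) = table \<psi> S"
      using set_enum_set[of S] by (simp add: table_def)
    then have "policy_of (marginal p f) (query_all (enum_set S) \<psi> g (\<lambda>_. 0)) =
        policy_of (marginal p f) (g (table \<psi> S))" for g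
      by (simp only: policy_of_query_all)
    with nonneg show "(policy_of (marginal p f) \<circ> (\<lambda>(S, j). query_all (enum_set S) \<psi>
          (\<lambda>v. let e = rk v S ! (j - 1) in
               if v e \<ge> 0 then Pick e (\<lambda>st. lt_rounds r E m s rk (\<psi>(e \<mapsto> st)))
               else lt_rounds r E m s rk \<psi>)
          (\<lambda>_. 0))) z = (\<lambda>(S, j). Select (rk (table \<psi> S) S ! (j - 1))
            (\<lambda>st. lt r m s rk (\<psi>(rk (table \<psi> S) S ! (j - 1) \<mapsto> st)))) z"
      by (simp add: z Let_def)
  qed
qed

text \<open>Induction on the remaining rounds for all \<open>\<psi>\<close> at once, with
  \<open>\<pi>\<close> restarted at the current \<open>\<psi>\<close>. The factor
  \<open>b ^ r\<close> is the share of the gap to \<open>\<pi>\<close> that \<open>r\<close> rounds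
  may leave open; a convex combination avoids subtraction in \<open>ennreal\<close>.\<close>

lemma val_lt_ge:
  assumes \<psi>: "realizable \<psi>" and feas: "feasible E St k \<pi>"
    and rk: "ranking_rule rk" and k: "1 \<le> k" "k \<le> card E"
    and m: "1 \<le> m" "m \<le> card E" and s: "s = real k * m / card E"
    and \<delta>: "0 \<le> \<delta>" "\<delta> \<le> 1" "m = card E \<or> 1 / (2 * sqrt s) \<le> \<delta>"
  defines "b \<equiv> 1 - (1 - \<delta>) / k"
  shows "ennreal (1 - b ^ r) * val F \<psi> \<pi> + ennreal (b ^ r) * val F \<psi> Stop \<le> val F \<psi> (lt r m s rk \<psi>)"
  using \<psi>
proof (induction r arbitrary: \<psi>)
  case 0
  then show ?case
    by simp
next
  case (Suc r)
  define a where "a = (1 - \<delta>) / k"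
  define c where "c = b ^ r"
  have a: "0 \<le> a" "a \<le> 1" "b = 1 - a"
    using \<delta> k by (auto simp: a_def b_def)
  have c: "0 \<le> c" "c \<le> 1"
    using a by (auto simp: c_def intro: power_le_one)
  have s': "0 < s" "s \<le> m"
    using k m unfolding s by (auto simp: field_simps)
  let ?v = "\<lambda>e. marginal p f e \<psi>"
  let ?SS = "{S. S \<subseteq> E \<and> card S = m}"
  let ?P = "pair_pmf (pmf_of_set ?SS) (rank_pmf s)"
  define pick where "pick = (\<lambda>(S, j). rk (table \<psi> S) S ! (j - 1))"
  define T where "T = sum ?v (top_items k rk ?v E)"
  have v: "0 \<le> ?v e" if "e \<in> E" for e
    using that Suc.prems by (intro marginal_nonneg)
  have ne: "?SS \<noteq> {}" "finite ?SS"
    using obtain_subset_with_card_n[OF m(2)] finite_E by auto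
  have pick_E: "pick z \<in> E" if "z \<in> set_pmf ?P" for z
  proof -
    have "z \<in> ?SS \<times> set_pmf (rank_pmf s)"
      using that ne by simp
    then obtain S j where z: "z = (S, j)" "S \<subseteq> E" "card S = m" "j \<in> set_pmf (rank_pmf s)"
      by blast
    then show ?thesis
      using pick_in_E[OF Suc.prems rk m(2) s', of S j] by (auto simp: pick_def)
  qed
  have T_nonneg: "0 \<le> T"
    unfolding T_def using top_items_subset[OF rk finite_E k(2)] v by (intro sum_nonneg) auto
  have opt: "val F \<psi> \<pi> \<le> val F \<psi> Stop + ennreal T"
    unfolding T_def using sum_le_top_items[OF rk finite_E k(2) v]
    by (intro val_feasible_le[OF Suc.prems feas])
  have gain: "ennreal (a * T) \<le> (\<integral>\<^sup>+z. ennreal (?v (pick z)) \<partial>?P)"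
    unfolding a_def T_def nn_integral_pair_pmf' pick_def
    by (simp only: split) (rule expected_pick_ge[OF rk finite_E k m s _ v \<delta>(1,3)], auto simp: table_def)
  \<comment> \<open>The induction hypothesis holds on each branch after \<open>e\<close>. Averaged
    over the observed state, it speaks of \<open>\<pi>\<close> run after selecting \<open>e\<close>,
    which is worth at least \<open>\<pi>\<close> run at \<open>\<psi>\<close>.\<close>
  have step: "ennreal (1 - c) * val F \<psi> \<pi> + ennreal c * (val F \<psi> Stop + ennreal (?v e)) \<le>
      val F \<psi> (Select e (\<lambda>st. lt r m s rk (\<psi>(e \<mapsto> st))))" if e: "e \<in> E" for e
  proof -
    have "ennreal (1 - c) * val F \<psi> \<pi> + ennreal c * (val F \<psi> Stop + ennreal (?v e)) \<le>
        ennreal (1 - c) * val F \<psi> (Select e (\<lambda>_. \<pi>)) + ennreal c * val F \<psi> (Select e (\<lambda>_. Stop))"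
      unfolding val_Select_Stop[OF Suc.prems e]
      by (intro add_right_mono mult_left_mono val_le_val_Select Suc.prems e selects_in_E_feasible[OF feas]) simp
    also have "\<dots> = (\<integral>\<^sup>+\<phi>. ennreal (1 - c) * val F (\<psi>(e \<mapsto> \<phi> e)) \<pi> + ennreal c * val F (\<psi>(e \<mapsto> \<phi> e)) Stop \<partial>posterior \<psi>)"
      by (simp add: val_Select[OF Suc.prems] nn_integral_add nn_integral_cmult)
    also have "\<dots> \<le> (\<integral>\<^sup>+\<phi>. val F (\<psi>(e \<mapsto> \<phi> e)) (lt r m s rk (\<psi>(e \<mapsto> \<phi> e))) \<partial>posterior \<psi>)"
    proof (intro nn_integral_mono_AE AE_pmfI)
      fix \<phi> assume "\<phi> \<in> set_pmf (posterior \<psi>)"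
      then show "ennreal (1 - c) * val F (\<psi>(e \<mapsto> \<phi> e)) \<pi> + ennreal c * val F (\<psi>(e \<mapsto> \<phi> e)) Stop \<le>
          val F (\<psi>(e \<mapsto> \<phi> e)) (lt r m s rk (\<psi>(e \<mapsto> \<phi> e)))"
        unfolding c_def by (intro Suc.IH realizable_upd Suc.prems e)
    qed
    also have "\<dots> = val F \<psi> (Select e (\<lambda>st. lt r m s rk (\<psi>(e \<mapsto> st))))"
      by (simp only: val_Select[OF Suc.prems])
    finally show ?thesis .
  qed
  \<comment> \<open>By \<open>opt\<close> the gap is at most \<open>T\<close>, and by
    \<open>gain\<close> the random pick closes at least \<open>a * T\<close> of it on
    average.\<close>
  have "ennreal (1 - b ^ Suc r) * val F \<psi> \<pi> + ennreal (b ^ Suc r) * val F \<psi> Stop \<le>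
      ennreal (1 - c) * val F \<psi> \<pi> + ennreal c * (val F \<psi> Stop + (\<integral>\<^sup>+z. ennreal (?v (pick z)) \<partial>?P))"
    using greedy_step_ennreal[OF a(1,2) c T_nonneg opt gain] by (simp add: a(3) c_def mult.commute)
  also have "\<dots> = (\<integral>\<^sup>+z. ennreal (1 - c) * val F \<psi> \<pi> + ennreal c * (val F \<psi> Stop + ennreal (?v (pick z))) \<partial>?P)"
    by (simp add: nn_integral_add nn_integral_cmult)
  also have "\<dots> \<le> (\<integral>\<^sup>+z. val F \<psi> (Select (pick z) (\<lambda>st. lt r m s rk (\<psi>(pick z \<mapsto> st)))) \<partial>?P)"
    by (intro nn_integral_mono_AE AE_pmfI step pick_E)
  also have "\<dots> = val F \<psi> (lt (Suc r) m s rk \<psi>)"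
    unfolding lt_Suc[OF Suc.prems rk m(2) s'] val_Flip nn_integral_map_pmf
    by (simp add: pick_def case_prod_unfold)
  finally show ?case .
qed

text \<open>The induction runs over arbitrary \<open>\<psi>\<close>, where the test in a round may
  fail, so both branches are followed.\<close>

lemma selects_in_E_lt:
  assumes rk: "ranking_rule rk" and m: "m \<le> card E" and s: "0 < s" "s \<le> real m" and A: "A \<in> set_pmf (selected \<phi> (lt r m s rk \<psi>))"
  shows "A \<subseteq> E"
  using A
proof (induction r arbitrary: \<psi> A)
  case (Suc r)
  let ?SS = "{S. S \<subseteq> E \<and> card S = m}"
  have ne: "?SS \<noteq> {}" "finite ?SS"
    using obtain_subset_with_card_n[OF m] finite_E by auto
  obtain S j where S: "S \<subseteq> E" "card S = m" and j: "j \<in> set_pmf (rank_pmf s)"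
    and A: "A \<in> set_pmf (selected \<phi> (policy_of (marginal p f) (query_all (enum_set S) \<psi>
          (\<lambda>v. let e = rk v S ! (j - 1) in
               if v e \<ge> 0 then Pick e (\<lambda>st. lt_rounds r E m s rk (\<psi>(e \<mapsto> st)))
               else lt_rounds r E m s rk \<psi>)
          (\<lambda>_. 0))))"
    using Suc.prems ne by auto
  define t where "t = (\<lambda>x. if x \<in> set (enum_set S) then marginal p f x \<psi> else 0)"
  have "finite S"
    using S(1) finite_E finite_subset by blast
  then have L: "distinct (rk t S)" "set (rk t S) = S"
    using rk by (auto simp: ranking_rule_def)
  then have "length (rk t S) = m"
    using S(2) distinct_card by metis
  then have "j - 1 < length (rk t S)"
    using set_pmf_rank_pmf[OF s j] by simp
  then have "rk t S ! (j - 1) \<in> E"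
    using L(2) S(1) nth_mem by blast
  then show ?case
    using A Suc.IH by (auto simp: policy_of_query_all Let_def t_def[symmetric] split: if_splits)
qed simp

lemma f_avg_linear_time_ge:
  assumes feas: "feasible E St k \<pi>"
    and rk: "ranking_rule rk" and k: "1 \<le> k" "k \<le> card E"
    and m: "1 \<le> m" "m \<le> card E" and s: "s = real k * m / card E"
    and \<delta>: "0 \<le> \<delta>" "\<delta> \<le> 1" "m = card E \<or> 1 / (2 * sqrt s) \<le> \<delta>"
  shows "(1 - 1 / exp 1) * (1 - \<delta>) * f_avg p f \<pi> \<le> f_avg p f (lt k m s rk Map.empty)"
proof -
  define u where "u = 1 - (1 - (1 - \<delta>) / real k) ^ k"
  have u: "(1 - 1 / exp 1) * (1 - \<delta>) \<le> u"
    unfolding u_def using one_minus_power_ge[OF k(1) \<delta>(1,2)] .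
  have u_nonneg: "0 \<le> u"
    using u \<delta> by (auto intro: order_trans[rotated])
  have s': "0 < s" "s \<le> m"
    using k m unfolding s by (auto simp: field_simps)
  have opt: "ennreal (f_avg p f \<pi>) = val F Map.empty \<pi>"
    by (intro f_avg_eq selects_in_E_feasible[OF feas])
  have lt: "ennreal (f_avg p f (lt k m s rk Map.empty)) = val F Map.empty (lt k m s rk Map.empty)"
    using selects_in_E_lt[OF rk m(2) s'] by (intro f_avg_eq) (auto simp: selects_in_E_def)
  have nonneg: "0 \<le> f_avg p f \<pi>'" if "selects_in_E Map.empty \<pi>'" for \<pi>'
    unfolding f_avg_def using that
    by (intro integral_nonneg_AE AE_pmfI) (auto simp: selects_in_E_def consistent_def intro!: f_nonneg integral_nonneg_AE AE_pmfI)
  have "ennreal (u * f_avg p f \<pi>) = ennreal u * val F Map.empty \<pi>"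
    using u_nonneg by (simp add: ennreal_mult' opt)
  \<comment> \<open>The nonnegative term for stopping at once is dropped.\<close>
  also have "\<dots> \<le> val F Map.empty (lt k m s rk Map.empty)"
    using val_lt_ge[OF realizable_empty feas rk k m s \<delta>, of k] unfolding u_def
    by (rule order_trans[rotated]) simp
  finally have "u * f_avg p f \<pi> \<le> f_avg p f (lt k m s rk Map.empty)"
    unfolding lt[symmetric]
    using nonneg[of "lt k m s rk Map.empty"] selects_in_E_lt[OF rk m(2) s']
    by (subst (asm) ennreal_le_iff) (auto simp: selects_in_E_def)
  moreover have "(1 - 1 / exp 1) * (1 - \<delta>) * f_avg p f \<pi> \<le> u * f_avg p f \<pi>"
    using u nonneg[OF selects_in_E_feasible[OF feas]] by (intro mult_right_mono)
  ultimately show ?thesis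
    by linarith
qed

end

section \<open>Query count and parameter bounds\<close>

lemma query_count_lt_rounds:
  assumes fin: "finite E" and m: "m \<le> card E" and c: "c \<in> set_pmf (query_count V \<phi> (lt_rounds r E m s rk \<psi>))"
  shows "c \<le> r * m"
  using c
proof (induction r arbitrary: \<psi> c)
  case (Suc r)
  have ne: "{S. S \<subseteq> E \<and> card S = m} \<noteq> {}" "finite {S. S \<subseteq> E \<and> card S = m}"
    using obtain_subset_with_card_n[OF m] fin by auto
  obtain S j where S: "S \<subseteq> E" "card S = m"
    and c: "c \<in> set_pmf (query_count V \<phi> (query_all (enum_set S) \<psi>
          (\<lambda>v. let e = rk v S ! (j - 1) in
               if v e \<ge> 0 then Pick e (\<lambda>st. lt_rounds r E m s rk (\<psi>(e \<mapsto> st)))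
               else lt_rounds r E m s rk \<psi>)
          (\<lambda>_. 0)))"
    using Suc.prems ne by auto
  have "length (enum_set S) = m"
    using set_enum_set[of S] S finite_subset[OF S(1) fin] distinct_card by metis
  then show ?case
    using c Suc.IH by (fastforce simp: query_count_query_all Let_def split: if_splits)
qed simp

lemma sampling_rate_bounds:
  assumes q: "sampling_rate k \<epsilon> q" and k: "1 \<le> k" and \<epsilon>: "0 < \<epsilon>" "\<epsilon> < 1 - 1 / exp 1"
  shows "1 / (2 * sqrt (k * q)) \<le> \<epsilon> / (1 - 1 / exp 1)" "0 < q"
    "k * q \<le> 32 * (1 / \<epsilon>\<^sup>2) * ln (1 / \<epsilon>)" "1 \<le> 3 * (1 / \<epsilon>\<^sup>2) * ln (1 / \<epsilon>)"
proof -
  have e: "exp 1 \<le> (3::real)"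
    by (rule exp_le)
  \<comment> \<open>The value \<open>4 / 5\<close> matches the bound \<open>1 / 50 \<le> L\<close>
    below: \<open>sqrt (8 / 50) = 2 / 5\<close>, which leads to
    \<open>1 / (2 * sqrt (k * q)) \<le> \<epsilon> / (4 / 5)\<close>.\<close>
  have e1: "1 - 1 / exp 1 \<le> (4 / 5 :: real)"
    using e by (simp add: field_simps)
  have e2: "0 < 1 - 1 / exp (1::real)"
    using exp_gt_one[of "1::real"] by (simp add: field_simps)
  have \<epsilon>1: "\<epsilon> < 1"
    using \<epsilon> by (smt (verit) divide_pos_pos exp_gt_zero)
  have ln_ge: "1 - x \<le> ln (1 / x)" if "0 < x" for x :: real
    using that ln_le_minus_one[of x] by (simp add: ln_div)
  have "1 / 3 \<le> 1 / exp (1::real)"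
    using e by (simp add: field_simps)
  then have l: "1 / 3 \<le> ln (1 / \<epsilon>)"
    using ln_ge[OF \<epsilon>(1)] \<epsilon>(2) by linarith
  define L where "L = \<epsilon>\<^sup>2 * (k * q) / 8"
  have kq: "k * q = 8 / \<epsilon>\<^sup>2 * L"
    using \<epsilon> by (simp add: L_def)
  have L: "L = ln (2 / \<epsilon>) \<or> L = ln (1 / (2 * \<epsilon>)) \<and> \<epsilon> \<le> 49 / 100"
    using q k \<epsilon> unfolding sampling_rate_def L_def by (auto simp: field_simps)
  \<comment> \<open>By \<open>1 - x \<le> ln (1 / x)\<close>, the first rate gives at least
    \<open>1 / 2\<close>, and the second at least \<open>1 - 98 / 100\<close> since
    \<open>\<epsilon> \<le> 49 / 100\<close>.\<close>
  have L_ge: "1 / 50 \<le> L"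
    using L ln_ge[of "\<epsilon> / 2"] ln_ge[of "2 * \<epsilon>"] \<epsilon>(1) \<epsilon>1 by auto
  \<comment> \<open>As \<open>ln (1 / \<epsilon>) \<ge> 1 / 3\<close>, the summand
    \<open>ln 2 \<le> 1\<close> costs at most \<open>3 * ln (1 / \<epsilon>)\<close>.\<close>
  have L_le: "L \<le> 4 * ln (1 / \<epsilon>)"
  proof -
    have "ln (2 / \<epsilon>) = ln 2 + ln (1 / \<epsilon>)" "ln (1 / (2 * \<epsilon>)) = ln (1 / \<epsilon>) - ln 2"
      using \<epsilon>(1) by (simp_all add: ln_div ln_mult)
    moreover have "0 < ln (2::real)" "ln (2::real) \<le> 1"
      using ln_le_minus_one[of 2] by auto
    ultimately have "ln (2 / \<epsilon>) \<le> 4 * ln (1 / \<epsilon>)" "ln (1 / (2 * \<epsilon>)) \<le> 4 * ln (1 / \<epsilon>)"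
      using l by linarith+
    then show ?thesis
      using L by metis
  qed
  have sq: "0 < \<epsilon>\<^sup>2"
    using \<epsilon> by simp
  have "0 < k * q"
    unfolding kq using sq L_ge by (intro mult_pos_pos) auto
  then show "0 < q"
    using k by (simp add: zero_less_mult_iff)
  show "k * q \<le> 32 * (1 / \<epsilon>\<^sup>2) * ln (1 / \<epsilon>)"
    unfolding kq using sq L_le by (simp add: field_simps)
  have "\<epsilon>\<^sup>2 \<le> 1"
    using \<epsilon>(1) \<epsilon>1 by (simp add: power_le_one)
  then have "1 \<le> 1 / \<epsilon>\<^sup>2"
    using sq by simp
  then have "1 * 1 \<le> 1 / \<epsilon>\<^sup>2 * (3 * ln (1 / \<epsilon>))"
    using l by (intro mult_mono) auto
  then show "1 \<le> 3 * (1 / \<epsilon>\<^sup>2) * ln (1 / \<epsilon>)"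
    by simp
  have "(2 / (5 * \<epsilon>))\<^sup>2 \<le> k * q"
    unfolding kq using sq L_ge by (simp add: field_simps power2_eq_square)
  then have "2 / (5 * \<epsilon>) \<le> sqrt (k * q)"
    using \<epsilon>(1) by (intro real_le_rsqrt)
  then have "1 / (2 * sqrt (k * q)) \<le> 1 / (2 * (2 / (5 * \<epsilon>)))"
    using \<epsilon>(1) by (intro divide_left_mono mult_left_mono) (auto intro!: mult_pos_pos simp: \<open>0 < k * q\<close>)
  also have "\<dots> = \<epsilon> / (4 / 5)"
    by simp
  also have "\<dots> \<le> \<epsilon> / (1 - 1 / exp 1)"
    by (rule divide_left_mono[OF e1 less_imp_le[OF \<epsilon>(1)] mult_pos_pos[OF _ e2]]) simp
  finally show "1 / (2 * sqrt (k * q)) \<le> \<epsilon> / (1 - 1 / exp 1)" .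
qed

theorem theorem4:
  shows "\<exists>C::real. \<forall>(E :: 'a set) (St :: 'b set) p f k \<epsilon> q rk.
    stochastic_instance E St p f \<longrightarrow>
    adaptive_submodular E St p f \<longrightarrow>
    adaptive_monotone E St p f \<longrightarrow>
    1 \<le> k \<longrightarrow> k \<le> card E \<longrightarrow>
    0 < \<epsilon> \<longrightarrow> \<epsilon> < 1 - 1 / exp 1 \<longrightarrow>
    sampling_rate k \<epsilon> q \<longrightarrow>
    ranking_rule rk \<longrightarrow>
      (\<forall>\<pi>opt. optimal_policy E St p f k \<pi>opt \<longrightarrow>
         f_avg p f (policy_of (marginal p f) (linear_time_alg E k q rk))
           \<ge> (1 - 1 / exp 1 - \<epsilon>) * f_avg p f \<pi>opt) \<and>
      (\<forall>\<phi>\<in>E \<rightarrow>\<^sub>E St. \<forall>c\<in>set_pmf (query_count (marginal p f) \<phi> (linear_time_alg E k q rk)).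
         real c \<le> C * real (card E) * (1 / \<epsilon>\<^sup>2) * ln (1 / \<epsilon>))"
\<comment> \<open>The constant is \<open>32 + 3\<close>: 32 from the sampling rate and 3 from
  rounding the sample size up.\<close>
proof (intro exI[of _ 35] allI impI)
  fix E :: "'a set" and St :: "'b set" and p :: "('a \<Rightarrow> 'b) pmf" and f and k :: nat and \<epsilon> q :: real
    and rk :: "('a \<Rightarrow> real) \<Rightarrow> 'a set \<Rightarrow> 'a list"
  assume inst: "stochastic_instance E St p f" "adaptive_submodular E St p f" "adaptive_monotone E St p f"
    and k: "1 \<le> k" "k \<le> card E" and \<epsilon>: "0 < \<epsilon>" "\<epsilon> < 1 - 1 / exp 1"
    and q: "sampling_rate k \<epsilon> q" and rk: "ranking_rule rk"
  interpret adaptive_utility E St p f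
    by unfold_locales (fact inst)+
  define n where "n = card E"
  define m where "m = nat (min \<lceil>q * real n\<rceil> (int n))"
  define s where "s = real k * m / n"
  define \<delta> where "\<delta> = \<epsilon> / (1 - 1 / exp 1)"
  note bounds = sampling_rate_bounds[OF q k(1) \<epsilon>]
  have n: "0 < n"
    using k by (simp add: n_def)
  have "0 < q * n"
    using n bounds(2) by simp
  then have "1 \<le> min \<lceil>q * n\<rceil> (int n)"
    using n by simp
  then have m: "1 \<le> m" "m \<le> card E"
    unfolding m_def n_def by linarith+
  have alg: "linear_time_alg E k q rk = lt_rounds k E m s rk Map.empty"
    by (simp add: linear_time_alg_def Let_def m_def n_def s_def)
  have \<delta>: "0 \<le> \<delta>" "\<delta> \<le> 1"
    using \<epsilon> by (auto simp: \<delta>_def)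
  have large: "m = card E \<or> 1 / (2 * sqrt s) \<le> \<delta>"
  proof (cases "m = card E")
    case False
    \<comment> \<open>The sample size is not capped at \<open>n\<close>, so rounding up gives
      \<open>q * n \<le> m\<close> and hence \<open>k * q \<le> s\<close>.\<close>
    then have "q * n \<le> m"
      using \<open>0 < q * n\<close> by (auto simp: m_def n_def min_def split: if_splits)
    then have "k * q \<le> s"
      using n by (simp add: s_def pos_le_divide_eq mult.assoc mult_left_mono)
    moreover have "0 < k * q"
      using k bounds(2) by simp
    ultimately have "1 / (2 * sqrt s) \<le> 1 / (2 * sqrt (k * q))"
      by (intro divide_left_mono) auto
    then show ?thesis
      using bounds(1) by (simp add: \<delta>_def)
  qed simp
  have "(1 - 1 / exp 1) * (1 - \<delta>) = 1 - 1 / exp 1 - \<epsilon>"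
    using \<epsilon> by (simp add: \<delta>_def right_diff_distrib)
  then have ratio: "(1 - 1 / exp 1 - \<epsilon>) * f_avg p f \<pi> \<le>
      f_avg p f (policy_of (marginal p f) (linear_time_alg E k q rk))" if "feasible E St k \<pi>" for \<pi>
    using f_avg_linear_time_ge[OF that rk k m s_def[unfolded n_def] \<delta> large] by (simp add: alg)
  have count: "real c \<le> 35 * real (card E) * (1 / \<epsilon>\<^sup>2) * ln (1 / \<epsilon>)"
    if "c \<in> set_pmf (query_count (marginal p f) \<phi> (linear_time_alg E k q rk))" for c \<phi>
  proof -
    let ?B = "(1 / \<epsilon>\<^sup>2) * ln (1 / \<epsilon>)"
    have "real m \<le> q * n + 1"
      using \<open>0 < q * n\<close> by (auto simp: m_def min_def) linarith+
    have "real c \<le> real k * m"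
      using query_count_lt_rounds[OF finite_E m(2)] that unfolding alg by (metis of_nat_le_iff of_nat_mult)
    also have "\<dots> \<le> k * (q * n + 1)"
      using \<open>real m \<le> q * n + 1\<close> by (intro mult_left_mono) auto
    \<comment> \<open>Since \<open>k \<le> n\<close>, rounding up in all \<open>k\<close> rounds
      costs at most \<open>n\<close> extra queries.\<close>
    also have "\<dots> \<le> k * q * n + n"
      using k by (simp add: n_def algebra_simps)
    also have "\<dots> \<le> 32 * ?B * n + 3 * ?B * n"
    proof -
      have "k * q \<le> 32 * ?B" "1 \<le> 3 * ?B"
        using bounds(3,4) by (simp_all add: mult.assoc)
      from this[THEN mult_right_mono, of "real n"] show ?thesis
        by linarith
    qed
    finally show ?thesis
      by (simp add: n_def algebra_simps)
  qed
  show "(\<forall>\<pi>opt. optimal_policy E St p f k \<pi>opt \<longrightarrow>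
         f_avg p f (policy_of (marginal p f) (linear_time_alg E k q rk))
           \<ge> (1 - 1 / exp 1 - \<epsilon>) * f_avg p f \<pi>opt) \<and>
      (\<forall>\<phi>\<in>E \<rightarrow>\<^sub>E St. \<forall>c\<in>set_pmf (query_count (marginal p f) \<phi> (linear_time_alg E k q rk)).
         real c \<le> 35 * real (card E) * (1 / \<epsilon>\<^sup>2) * ln (1 / \<epsilon>))"
    using ratio count by (auto simp: optimal_policy_def)
qed

end
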